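(* Let $G$ be a finite simple $3$-connected graph that is not isomorphic to $K_4$, not isomorphic to the prism $K_3 \times K_2$, and not isomorphic to the graph $(K_3 \times K_2)^+$ obtained from the prism by adding a single edge. Then every DFS tree of $G$ contains at least two $3$-contractible edges.
   Context: All graphs are finite, simple and undirected. A graph $G$ is $k$-connected ($k\ge 1$) if $|V(G)|>k$ and $G-T$ is connected for every $T\subseteq V(G)$ with $|T|<k$. For an edge $e$, $G/e$ denotes the graph obtained by identifying the two endvertices of $e$ and simplifying (removing loops and multiple edges). An edge $e$ of a $k$-connected graph $G$ is $k$-contractible if $G/e$ is $k$-connected. The prism $K_3\times K_2$ is the Cartesian product of a triangle and an edge (6 vertices, two disjoint triangles joined by a perfect matching); up to isomorphism there is a unique graph obtained from it by adding one edge. A DFS tree of $G$ is a spanning tree $Q$ of $G$ with a prescribed root vertex $r$ such that for every vertex $x$, any two $x$-branches are nonadjacent in $G$, where an $x$-branch is the vertex set of a component of $Q-x$ not containing $r$. *)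

theory Defs
  imports Main
begin

section \<open>Finite simple graphs\<close>

record 'a ugraph =
  verts :: "'a set"
  edges :: "'a set set"

definition simple_graph :: "'a ugraph \<Rightarrow> bool" where
  "simple_graph G \<longleftrightarrow> finite (verts G) \<and> (\<forall>e\<in>edges G. e \<subseteq> verts G \<and> card e = 2)"

definition graph_iso :: "'a ugraph \<Rightarrow> 'b ugraph \<Rightarrow> bool" where
  "graph_iso G H \<longleftrightarrow>
     (\<exists>f. bij_betw f (verts G) (verts H) \<and> edges H = (\<lambda>e. f ` e) ` edges G)"

definition complete_graph :: "nat \<Rightarrow> nat ugraph" where
  "complete_graph n = \<lparr>verts = {..<n}, edges = {e. e \<subseteq> {..<n} \<and> card e = 2}\<rparr>"

definition cartesian_product :: "'a ugraph \<Rightarrow> 'b ugraph \<Rightarrow> ('a \<times> 'b) ugraph" where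
  "cartesian_product G H =
     \<lparr>verts = verts G \<times> verts H,
      edges = {{(a, b), (a', b)} | a a' b. {a, a'} \<in> edges G \<and> b \<in> verts H} \<union>
              {{(a, b), (a, b')} | a b b'. a \<in> verts G \<and> {b, b'} \<in> edges H}\<rparr>"

definition add_edge :: "'a ugraph \<Rightarrow> 'a set \<Rightarrow> 'a ugraph" where
  "add_edge G e = G\<lparr>edges := insert e (edges G)\<rparr>"

definition delete_verts :: "'a ugraph \<Rightarrow> 'a set \<Rightarrow> 'a ugraph" where
  "delete_verts G T = \<lparr>verts = verts G - T, edges = {e \<in> edges G. e \<inter> T = {}}\<rparr>"

section \<open>Connectivity and contraction\<close>

definition adjacent :: "'a ugraph \<Rightarrow> 'a \<Rightarrow> 'a \<Rightarrow> bool" where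
  "adjacent G u v \<longleftrightarrow> {u, v} \<in> edges G"

definition connected_graph :: "'a ugraph \<Rightarrow> bool" where
  "connected_graph G \<longleftrightarrow>
     verts G \<noteq> {} \<and> (\<forall>u\<in>verts G. \<forall>v\<in>verts G. (adjacent G)\<^sup>*\<^sup>* u v)"

definition components :: "'a ugraph \<Rightarrow> 'a set set" where
  "components G = (\<lambda>u. {v \<in> verts G. (adjacent G)\<^sup>*\<^sup>* u v}) ` verts G"

definition k_connected :: "nat \<Rightarrow> 'a ugraph \<Rightarrow> bool" where
  "k_connected k G \<longleftrightarrow>
     card (verts G) > k \<and>
     (\<forall>T\<subseteq>verts G. card T < k \<longrightarrow> connected_graph (delete_verts G T))"

text \<open>
  The vertices of \<open>contract G e\<close> are the classes of the partition of \<open>verts G\<close> that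
  identifies the two ends of \<open>e\<close>: the class \<open>e\<close> itself and the singletons of the
  other vertices. Subtracting \<open>{{e}}\<close> removes the loop that arises from \<open>e\<close>;
  parallel edges coincide as sets.
\<close>

definition contract_vertex :: "'a set \<Rightarrow> 'a \<Rightarrow> 'a set" where
  "contract_vertex e x = (if x \<in> e then e else {x})"

definition contract :: "'a ugraph \<Rightarrow> 'a set \<Rightarrow> 'a set ugraph" where
  "contract G e =
     \<lparr>verts = contract_vertex e ` verts G,
      edges = (\<lambda>f. contract_vertex e ` f) ` edges G - {{e}}\<rparr>"

definition k_contractible :: "nat \<Rightarrow> 'a ugraph \<Rightarrow> 'a set \<Rightarrow> bool" where
  "k_contractible k G e \<longleftrightarrow>
     k_connected k G \<and> e \<in> edges G \<and> k_connected k (contract G e)"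

section \<open>Depth-first search trees\<close>

definition is_cycle :: "'a ugraph \<Rightarrow> 'a list \<Rightarrow> bool" where
  "is_cycle G xs \<longleftrightarrow>
     length xs \<ge> 3 \<and> distinct xs \<and> set xs \<subseteq> verts G \<and>
     (\<forall>i<length xs. adjacent G (xs ! i) (xs ! (Suc i mod length xs)))"

definition tree :: "'a ugraph \<Rightarrow> bool" where
  "tree Q \<longleftrightarrow> simple_graph Q \<and> connected_graph Q \<and> (\<nexists>xs. is_cycle Q xs)"

definition spanning_tree :: "'a ugraph \<Rightarrow> 'a ugraph \<Rightarrow> bool" where
  "spanning_tree G Q \<longleftrightarrow> tree Q \<and> verts Q = verts G \<and> edges Q \<subseteq> edges G"

definition branches :: "'a ugraph \<Rightarrow> 'a \<Rightarrow> 'a \<Rightarrow> 'a set set" where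
  "branches Q r x = {B \<in> components (delete_verts Q {x}). r \<notin> B}"

definition dfs_tree :: "'a ugraph \<Rightarrow> 'a ugraph \<Rightarrow> 'a \<Rightarrow> bool" where
  "dfs_tree G Q r \<longleftrightarrow>
     spanning_tree G Q \<and> r \<in> verts G \<and>
     (\<forall>x\<in>verts G. \<forall>B\<in>branches Q r x. \<forall>C\<in>branches Q r x.
        B \<noteq> C \<longrightarrow> (\<forall>b\<in>B. \<forall>c\<in>C. \<not> adjacent G b c))"

section \<open>The prism\<close>

definition prism :: "(nat \<times> nat) ugraph" where
  "prism = cartesian_product (complete_graph 3) (complete_graph 2)"

definition prism_plus :: "(nat \<times> nat) ugraph" where
  "prism_plus = add_edge prism {(0, 0), (1, 1)}"

lemma verts_prism: "verts prism = {..<3} \<times> {..<2}"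
  by (simp add: prism_def cartesian_product_def complete_graph_def)

lemma edges_complete_graph_iff:
  "{a, c} \<in> edges (complete_graph n) \<longleftrightarrow> a < n \<and> c < n \<and> a \<noteq> c"
  by (auto simp: complete_graph_def card_insert_if)

lemma edges_cartesian_product_iff:
  "{(a, b), (c, d)} \<in> edges (cartesian_product G H) \<longleftrightarrow>
     {a, c} \<in> edges G \<and> b = d \<and> b \<in> verts H \<or> a = c \<and> a \<in> verts G \<and> {b, d} \<in> edges H"
  (is "?L \<longleftrightarrow> ?R")
proof
  show "?L \<Longrightarrow> ?R"
    by (auto simp: cartesian_product_def doubleton_eq_iff insert_commute)
  show "?R \<Longrightarrow> ?L"
    unfolding cartesian_product_def ugraph.simps Un_iff mem_Collect_eq by blast
qed

lemma edges_prism_iff: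
  "{(a, b), (c, d)} \<in> edges prism \<longleftrightarrow>
     a < 3 \<and> c < 3 \<and> b < 2 \<and> d < 2 \<and> (a = c \<and> b \<noteq> d \<or> a \<noteq> c \<and> b = d)"
  by (auto simp: prism_def edges_cartesian_product_iff edges_complete_graph_iff)
    (simp_all add: complete_graph_def)

lemma edges_prism:
  "edges prism = {{(0,0),(1,0)}, {(0,0),(2,0)}, {(1,0),(2,0)},
     {(0,1),(1,1)}, {(0,1),(2,1)}, {(1,1),(2,1)},
     {(0,0),(0,1)}, {(1,0),(1,1)}, {(2,0),(2,1)}}" (is "_ = ?E")
proof
  show "?E \<subseteq> edges prism"
    by (simp add: edges_prism_iff)
  show "edges prism \<subseteq> ?E"
  proof
    fix e assume e: "e \<in> edges prism"
    then obtain a b c d where eq: "e = {(a, b), (c, d)}"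
      by (auto simp: prism_def cartesian_product_def)
    then have "a < 3" "c < 3" "b < 2" "d < 2" "a = c \<and> b \<noteq> d \<or> a \<noteq> c \<and> b = d"
      using e edges_prism_iff by metis+
    then have "a \<in> {0,1,2}" "c \<in> {0,1,2}" "b \<in> {0,1}" "d \<in> {0,1}"
        "a = c \<and> b \<noteq> d \<or> a \<noteq> c \<and> b = d"
      by auto
    then show "e \<in> ?E"
      unfolding eq by (elim insertE emptyE) (simp_all add: insert_commute)
  qed
qed

text \<open>
  Up to isomorphism the choice of the added edge is immaterial.
\<close>

lemma prism_plus_unique:
  assumes "e \<subseteq> verts prism" "card e = 2" "e \<notin> edges prism"
  shows "graph_iso (add_edge prism e) prism_plus"
proof -
  obtain p q where pq: "e = {p, q}" "p \<noteq> q"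
    using assms(2) by (meson card_2_iff)
  obtain a b c d where p: "p = (a, b)" and q: "q = (c, d)"
    by (cases p, cases q)
  have "a < 3" "c < 3" "b < 2" "d < 2" "a \<noteq> c" "b \<noteq> d"
    using assms pq(2) unfolding pq(1) p q by (auto simp: verts_prism edges_prism_iff)
  then have "\<exists>i j. i < 3 \<and> j < 3 \<and> i \<noteq> j \<and> e = {(i, 0), (j, 1)}"
    unfolding pq(1) p q by (cases "b = 0") (auto simp: less_2_cases_iff insert_commute)
  then obtain i j where ij: "i < 3" "j < 3" "i \<noteq> j" and e: "e = {(i, 0), (j, 1)}"
    by blast
  define s :: "nat \<Rightarrow> nat" where "s x = (if x = i then 0 else if x = j then 1 else 2)" for x
  define f :: "nat \<times> nat \<Rightarrow> nat \<times> nat" where "f = (\<lambda>(x, y). (s x, y))"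
  have cases: "i \<in> {0,1,2}" "j \<in> {0,1,2}"
    using ij by auto
  have v: "verts prism = {(0,0),(1,0),(2,0),(0,1),(1,1),(2,1)}"
    by (auto simp: verts_prism less_2_cases_iff)
  have f_verts: "f ` verts prism = verts prism" and inj: "inj_on f (verts prism)"
    using cases ij(3) unfolding v f_def s_def inj_on_def
    by (elim insertE emptyE; auto)+
  have f_edges: "(\<lambda>e. f ` e) ` edges prism = edges prism"
    using cases ij(3) unfolding edges_prism f_def s_def
    by (elim insertE emptyE) (simp_all add: insert_commute)
  have "f ` e = {(0, 0), (1, 1)}"
    using ij(3) by (simp add: e f_def s_def)
  then show ?thesis
    unfolding graph_iso_def
    by (intro exI[of _ f])
      (simp add: bij_betw_def add_edge_def prism_plus_def f_verts inj f_edges)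
qed

end

(*
  An edge xy that is not 3-contractible lies in a 3-separator, the boundary of a fragment.
  Suppose Q has at most one contractible edge c, and consider inclusion-minimal fragments whose
  boundary contains a noncontractible edge of Q at a leaf of Q. An uncrossing argument in the
  style of Mader shows that such a fragment either meets c or has a cubic boundary vertex z with
  c = zu and N(z) = {p, q, u}, where pq is a leaf edge of Q inside the fragment. As every fragment
  has a complementary one not adjacent to it, the second case occurs, and then it occurs at both
  ends of c. Thus c joins two cubic vertices, each in a triangle with a leaf edge of Q; the DFS
  property rules out any further vertices, which leaves the prism with at most two more edges.
  With two more edges, Q would have a second contractible edge.
*)

theory Submission
  imports Defs
begin

text \<open>Contractibility enters only through one implication: an edge in no 3-separator is
  contractible. So it suffices to count the nonseparating edges of Q. Minimality is by inclusion,
  not by size, because minimal fragments (ends) are needed inside prescribed fragments: on both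
  sides of a separator, and later beyond a cubic vertex. The obstacle is that uncrossing needs an
  edge of the chosen class that meets the end. Connectivity of Q supplies an edge leaving the end,
  but that need not be a leaf edge. Hence two classes are used: inside an end for the separating
  leaf edges lies an end for all separating edges of Q. If no nonseparating tree edge meets it, a
  tree edge leaving it forces it to be a single vertex, which turns out to be a leaf of Q; its leaf
  edge then drives the uncrossing of the outer end. Leaf edges in the outer boundary pay off because
  two leaves with a common tree neighbour are nonadjacent, which excludes outer ends with one
  vertex. The argument can start because Q has two leaf edges, one of which is separating. At its
  close, the DFS property forces the root to be one of the two leaves found.\<close>

section \<open>Arithmetic of two crossing 3-separators\<close>

text \<open>In the notation of \<open>end_cases\<close>, \<open>m11\<close>, \<open>m13\<close>,
  \<open>m31\<close>, \<open>m33\<close> are the sizes of the corners \<open>A \<inter> F\<close>,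
  \<open>A \<inter> D\<close>, \<open>B \<inter> F\<close>, \<open>B \<inter> D\<close>, while
  \<open>a1\<close>, \<open>a2\<close>, \<open>a3\<close> split the separator \<open>T\<close> and
  \<open>b1\<close>, \<open>a2\<close>, \<open>b3\<close> split \<open>U\<close>. The bounding sets
  of two opposite corners have total size 6, so a nonempty corner in \<open>A\<close>, which needs
  4, forces the opposite corner, which needs 3, to be empty.\<close>

lemma corner_arith:
  fixes a1 a2 a3 :: nat
  assumes eqs: "cA = m11 + b1 + m13" "cB = m31 + b3 + m33" "cF = m11 + a1 + m31" "cD = m13 + a3 + m33"
    "3 = a1 + a2 + a3" "3 = b1 + a2 + b3" "cA \<ge> 2" "cF \<ge> 1" "cD \<ge> 1" "cB \<ge> 1" "b1 \<ge> 1"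
    and m11: "m11 > 0 \<Longrightarrow> a1 + a2 + b1 \<ge> 4" and m13: "m13 > 0 \<Longrightarrow> a3 + a2 + b1 \<ge> 4"
    and m31: "m31 > 0 \<Longrightarrow> a1 + a2 + b3 \<ge> 3" and m33: "m33 > 0 \<Longrightarrow> a3 + a2 + b3 \<ge> 3"
    and b3: "m31 = 0 \<Longrightarrow> a1 > 0 \<Longrightarrow> b3 > 0" "m33 = 0 \<Longrightarrow> a3 > 0 \<Longrightarrow> b3 > 0"
  shows "b1 = 2 \<and> b3 = 1 \<and> a2 = 0 \<and> (cF = 1 \<and> a1 = 1 \<or> cD = 1 \<and> a3 = 1)"
proof (cases "m11 = 0")
  case False
  then have "m33 = 0" using m11 m33 eqs by linarith
  moreover have "m13 = 0"
  proof (rule ccontr)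
    assume "m13 \<noteq> 0"
    then have "m31 = 0" "m33 = 0" using m11 m13 m31 m33 eqs False by linarith+
    then show False using m11 m13 eqs False \<open>m13 \<noteq> 0\<close> by linarith
  qed
  ultimately have "a3 > 0" "m33 = 0" "m13 = 0" using eqs by linarith+
  then show ?thesis using b3(2) m11 eqs False by linarith
next
  case 11: True
  show ?thesis
  proof (cases "m13 = 0")
    case False
    then have "m31 = 0" using m13 m31 eqs by linarith
    then have "a1 > 0" using eqs 11 by linarith
    then show ?thesis using b3(1) m13 eqs False 11 \<open>m31 = 0\<close> by linarith
  next
    case True
    \<comment> \<open>Both corners in \<open>A\<close> are empty, so \<open>A\<close> lies entirely
      in the second separator.\<close>
    then have "b1 \<ge> 2" using 11 eqs by linarith
    show ?thesis
    proof (cases "m31 = 0")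
      case 31: True
      then have "a1 > 0" using eqs(3,8) 11 by linarith
      then have "b3 > 0" using b3(1) 31 by blast
      then have *: "b1 = 2" "b3 = 1" "a2 = 0" using eqs(6) \<open>b1 \<ge> 2\<close> by linarith+
      show ?thesis
      proof (cases "m33 = 0")
        case True
        then have "a3 > 0" using eqs(4,9) \<open>m13 = 0\<close> by linarith
        then have "a1 = 1 \<or> a3 = 1" using eqs(5) \<open>a1 > 0\<close> * by linarith
        then show ?thesis using * 11 31 True \<open>m13 = 0\<close> eqs(3,4) by auto
      next
        case False
        then have "a3 \<ge> 2" using m33 * by linarith
        then show ?thesis using * 11 31 eqs(3,5) \<open>a1 > 0\<close> by simp
      qed
    next
      case False
      then have "a1 \<ge> 2" using m31 eqs(6) \<open>b1 \<ge> 2\<close> by linarith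
      then have "m33 = 0" using m33 eqs(5,6) \<open>b1 \<ge> 2\<close> by linarith
      then have "a3 > 0" using eqs(4,9) True by linarith
      then have "b3 > 0" using b3(2) \<open>m33 = 0\<close> by blast
      then have *: "b1 = 2" "b3 = 1" "a2 = 0" using eqs(6) \<open>b1 \<ge> 2\<close> by linarith+
      then show ?thesis using eqs(4,5) \<open>a1 \<ge> 2\<close> \<open>a3 > 0\<close> \<open>m33 = 0\<close> True by simp
    qed
  qed
qed

section \<open>Recognising the prism from a labelling of six vertices\<close>

definition prism_edges :: "'a \<Rightarrow> 'a \<Rightarrow> 'a \<Rightarrow> 'a \<Rightarrow> 'a \<Rightarrow> 'a \<Rightarrow> 'a set set" where
  "prism_edges a0 a1 a2 b0 b1 b2 = {{a0, a1}, {a0, a2}, {a1, a2}, {b0, b1}, {b0, b2}, {b1, b2},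
     {a0, b0}, {a1, b1}, {a2, b2}}"

lemma graph_iso_prism:
  assumes d: "distinct [a0, a1, a2, b0, b1, b2]" and V: "verts G = {a0, a1, a2, b0, b1, b2}"
  shows "edges G = prism_edges a0 a1 a2 b0 b1 b2 \<Longrightarrow> graph_iso G prism"
    and "edges G = insert {a0, b1} (prism_edges a0 a1 a2 b0 b1 b2) \<Longrightarrow> graph_iso G prism_plus"
proof -
  define f :: "'a \<Rightarrow> nat \<times> nat" where
    "f x = (if x = a0 then (0, 0) else if x = a1 then (1, 0) else if x = a2 then (2, 0)
       else if x = b0 then (0, 1) else if x = b1 then (1, 1) else (2, 1))" for x
  have f: "f a0 = (0, 0)" "f a1 = (1, 0)" "f a2 = (2, 0)" "f b0 = (0, 1)" "f b1 = (1, 1)" "f b2 = (2, 1)"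
    using d by (auto simp: f_def)
  have vp: "verts prism = {(0, 0), (1, 0), (2, 0), (0, 1), (1, 1), (2, 1)}"
    by (auto simp: verts_prism less_2_cases_iff)
  have bij: "bij_betw f (verts G) (verts prism)"
    unfolding V vp bij_betw_def by (auto simp: f)
  have im: "(\<lambda>e. f ` e) ` prism_edges a0 a1 a2 b0 b1 b2 = edges prism"
    unfolding prism_edges_def edges_prism by (simp add: f)
  show "graph_iso G prism" if "edges G = prism_edges a0 a1 a2 b0 b1 b2"
    unfolding graph_iso_def that using bij im by blast
  show "graph_iso G prism_plus" if "edges G = insert {a0, b1} (prism_edges a0 a1 a2 b0 b1 b2)"
    unfolding graph_iso_def that prism_plus_def add_edge_def using bij
    by (intro exI[of _ f]) (simp add: im f)
qed

section \<open>Fragments\<close>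

text \<open>3-connectivity in the only form used below; the neighbourhood is spelled out because
  \<open>nbrs\<close> is defined only inside the locale. The bound 5 leaves a vertex beyond a cubic
  vertex and its neighbours, and enough vertices after a contraction.\<close>

locale conn3 =
  fixes V :: "'a set" and E :: "'a set set"
  assumes finV: "finite V"
    and edgeE: "e \<in> E \<Longrightarrow> \<exists>x\<in>V. \<exists>y\<in>V. x \<noteq> y \<and> e = {x, y}"
    and card_nbrs: "\<And>F. F \<subseteq> V \<Longrightarrow> F \<noteq> {} \<Longrightarrow>
      V - F - {v\<in>V - F. \<exists>w\<in>F. {v, w} \<in> E} \<noteq> {} \<Longrightarrow> card {v\<in>V - F. \<exists>w\<in>F. {v, w} \<in> E} \<ge> 3"
    and card_V: "card V \<ge> 5"
begin

definition nbrs :: "'a set \<Rightarrow> 'a set" where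
  "nbrs F = {v\<in>V - F. \<exists>w\<in>F. {v, w} \<in> E}"

text \<open>The union of some, but not all, components left by a 3-separator.\<close>

definition fragment :: "'a set \<Rightarrow> bool" where
  "fragment F \<longleftrightarrow> F \<noteq> {} \<and> F \<subseteq> V \<and> V - F - nbrs F \<noteq> {} \<and> card (nbrs F) = 3"

definition separating :: "'a set \<Rightarrow> bool" where
  "separating e \<longleftrightarrow> (\<exists>F. fragment F \<and> e \<subseteq> nbrs F)"

definition frag_of :: "'a set set \<Rightarrow> 'a set \<Rightarrow> bool" where
  "frag_of S F \<longleftrightarrow> fragment F \<and> (\<exists>e\<in>S. e \<subseteq> nbrs F)"

definition end_of :: "'a set set \<Rightarrow> 'a set \<Rightarrow> bool" where
  "end_of S A \<longleftrightarrow> frag_of S A \<and> (\<forall>B. B \<subset> A \<longrightarrow> \<not> frag_of S B)"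

lemma edge_ends: "{x, y} \<in> E \<Longrightarrow> x \<in> V \<and> y \<in> V \<and> x \<noteq> y"
  using edgeE[of "{x, y}"] by (auto simp: doubleton_eq_iff)

lemma nbrs_subset: "nbrs F \<subseteq> V" and nbrs_disjoint: "nbrs F \<inter> F = {}"
  and finite_nbrs: "finite (nbrs F)"
  using finV by (auto simp: nbrs_def)

lemma card_nbrs_ge:
  assumes "F \<subseteq> V" "F \<noteq> {}" "nbrs F \<subseteq> C" "V - F - C \<noteq> {}"
  shows "card (nbrs F) \<ge> 3"
  using card_nbrs[OF assms(1,2)] assms(3,4) unfolding nbrs_def by blast

lemma closed_nbr: "{x, y} \<in> E \<Longrightarrow> x \<in> F \<Longrightarrow> y \<in> F \<or> y \<in> nbrs F"
  using edge_ends[of x y] by (auto simp: nbrs_def insert_commute)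

lemma card_nbrs_vertex: "v \<in> V \<Longrightarrow> card (nbrs {v}) \<ge> 3"
proof (cases "V - {v} - nbrs {v} = {}")
  case True
  assume v: "v \<in> V"
  have "card (V - {v}) \<le> card (nbrs {v})"
    using True by (intro card_mono finite_nbrs) auto
  then show ?thesis using card_V v finV by simp
next
  case False
  assume "v \<in> V"
  then show ?thesis using card_nbrs_ge[of "{v}" "nbrs {v}"] False by simp
qed

lemma nbrs_vertex: "y \<in> nbrs {x} \<longleftrightarrow> {x, y} \<in> E"
  using edge_ends[of x y] by (auto simp: nbrs_def insert_commute)

text \<open>No edge joins \<open>F\<close> to the far side, so the neighbours of the far side lie in
  \<open>nbrs F\<close>; the lower bound 3 forces equality.\<close>

lemma fragment_co:
  assumes "fragment F"
  shows "fragment (V - F - nbrs F)" "nbrs (V - F - nbrs F) = nbrs F"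
proof -
  let ?C = "V - F - nbrs F"
  have sub: "nbrs ?C \<subseteq> nbrs F"
  proof
    fix v assume "v \<in> nbrs ?C"
    then obtain w where "v \<in> V" "v \<notin> ?C" "w \<in> ?C" "{v, w} \<in> E" by (auto simp: nbrs_def)
    then show "v \<in> nbrs F" using closed_nbr[of v w F] by blast
  qed
  have F: "F \<noteq> {}" "F \<subseteq> V" "?C \<noteq> {}" "card (nbrs F) = 3"
    using assms by (auto simp: fragment_def)
  have "F \<subseteq> V - ?C - nbrs F" using F nbrs_disjoint by blast
  then have "V - ?C - nbrs F \<noteq> {}" using F(1) by blast
  then have "card (nbrs ?C) \<ge> 3"
    using card_nbrs_ge[of ?C "nbrs F"] sub F by blast
  then show eq: "nbrs ?C = nbrs F"
    using sub F(4) by (metis card_seteq finite_nbrs)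
  show "fragment ?C"
    unfolding fragment_def eq using F \<open>V - ?C - nbrs F \<noteq> {}\<close> by blast
qed

lemma fragmentI:
  assumes "F \<noteq> {}" "F \<subseteq> V" "nbrs F \<subseteq> C" "V - F - C \<noteq> {}" "card C = 3"
  shows "fragment F" "nbrs F = C"
proof -
  have "finite C" using assms(5) card.infinite by fastforce
  then show eq: "nbrs F = C"
    using card_nbrs_ge[of F C] assms by (metis card_seteq)
  show "fragment F" using assms eq by (simp add: fragment_def)
qed

lemma end_exists:
  assumes "frag_of S F" obtains A where "end_of S A" "A \<subseteq> F"
proof -
  have "finite F" using assms finV finite_subset unfolding frag_of_def fragment_def by blast
  then have "\<exists>A. end_of S A \<and> A \<subseteq> F" using assms
  proof (induction F rule: finite_psubset_induct)
    case (psubset F)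
    show ?case
    proof (cases "end_of S F")
      case False
      then obtain B where B: "B \<subset> F" "frag_of S B" using psubset.prems by (auto simp: end_of_def)
      then obtain A where "end_of S A" "A \<subseteq> B" using psubset.IH[of B] by auto
      then show ?thesis using B(1) by blast
    qed blast
  qed
  then show ?thesis using that by blast
qed

text \<open>A boundary vertex has neighbours on both sides. With \<open>u\<close> in the boundary
  only \<open>p\<close> and \<open>q\<close> are left for \<open>f\<close>, and they are
  adjacent.\<close>

lemma not_separating:
  assumes "nbrs {f} = {p, q, u}" "{p, q} \<in> E"
  shows "\<not> separating {f, u}"
proof
  assume "separating {f, u}"
  then obtain F where F: "fragment F" "{f, u} \<subseteq> nbrs F" by (auto simp: separating_def)
  let ?C = "V - F - nbrs F"
  have "f \<in> nbrs F" "f \<in> nbrs ?C" using F fragment_co by auto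
  then obtain v w where v: "v \<in> F" "{f, v} \<in> E" and w: "w \<in> ?C" "{f, w} \<in> E"
    by (auto simp: nbrs_def)
  have "v \<in> {p, q}" "w \<in> {p, q}"
    using v w assms(1) F nbrs_disjoint nbrs_vertex[of _ f] by blast+
  then have "{v, w} \<in> E" using v(1) w(1) assms(2) by (auto simp: insert_commute)
  then show False using closed_nbr v(1) w(1) by blast
qed

lemma card_split3:
  assumes "finite X" "X \<subseteq> V" "V = P \<union> Q \<union> R" "P \<inter> Q = {}" "P \<inter> R = {}" "Q \<inter> R = {}"
  shows "card X = card (X \<inter> P) + card (X \<inter> Q) + card (X \<inter> R)"
proof -
  have "X = X \<inter> P \<union> X \<inter> Q \<union> X \<inter> R" using assms by blast
  then have "card X = card (X \<inter> P \<union> X \<inter> Q \<union> X \<inter> R)" by simp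
  also have "\<dots> = card (X \<inter> P \<union> X \<inter> Q) + card (X \<inter> R)"
    by (rule card_Un_disjoint) (use assms in auto)
  also have "card (X \<inter> P \<union> X \<inter> Q) = card (X \<inter> P) + card (X \<inter> Q)"
    by (rule card_Un_disjoint) (use assms in auto)
  finally show ?thesis .
qed

text \<open>Uncrossing: a neighbour of \<open>A \<inter> F\<close> lies in \<open>A\<close> or its
  boundary, and in \<open>F\<close> or its boundary. This leaves exactly the three disjoint parts of
  \<open>K\<close>.\<close>

lemma corner:
  assumes "fragment A" "fragment F" "A \<inter> F \<noteq> {}"
  defines "K \<equiv> nbrs A \<inter> F \<union> nbrs A \<inter> nbrs F \<union> nbrs F \<inter> A"
  shows "card (nbrs A \<inter> F) + card (nbrs A \<inter> nbrs F) + card (nbrs F \<inter> A) \<ge> 3"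
    and "card (nbrs A \<inter> F) + card (nbrs A \<inter> nbrs F) + card (nbrs F \<inter> A) = 3 \<Longrightarrow>
      fragment (A \<inter> F) \<and> nbrs (A \<inter> F) = K"
proof -
  have sub: "nbrs (A \<inter> F) \<subseteq> K"
  proof
    fix v assume "v \<in> nbrs (A \<inter> F)"
    then obtain w where w: "v \<notin> A \<inter> F" "w \<in> A" "w \<in> F" "{w, v} \<in> E"
      by (auto simp: nbrs_def insert_commute)
    then show "v \<in> K" using closed_nbr[OF w(4,2)] closed_nbr[OF w(4,3)] by (auto simp: K_def)
  qed
  have V: "A \<inter> F \<subseteq> V" "V - A \<inter> F - K \<noteq> {}"
    using assms(1) by (auto simp: fragment_def K_def)
  have "finite F" "finite A" using assms finV finite_subset unfolding fragment_def by blast+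
  then have K: "card K = card (nbrs A \<inter> F) + card (nbrs A \<inter> nbrs F) + card (nbrs F \<inter> A)"
    unfolding K_def using nbrs_disjoint[of F] nbrs_disjoint[of A]
    by (subst card_Un_disjoint; (subst card_Un_disjoint)?) (auto simp: finite_nbrs)
  have "finite K" using \<open>finite F\<close> \<open>finite A\<close> by (auto simp: K_def finite_nbrs)
  then show "card (nbrs A \<inter> F) + card (nbrs A \<inter> nbrs F) + card (nbrs F \<inter> A) \<ge> 3"
    using card_nbrs_ge[OF V(1) assms(3) sub V(2)] card_mono[OF _ sub] K by linarith
  show "fragment (A \<inter> F) \<and> nbrs (A \<inter> F) = K"
    if "card (nbrs A \<inter> F) + card (nbrs A \<inter> nbrs F) + card (nbrs F \<inter> A) = 3"
    using fragmentI[OF assms(3) V(1) sub V(2)] that K by simp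
qed

text \<open>
  In Mader's theory an end of minimum size has size at most one in this situation; for
  inclusion-minimal ends the second alternative, a cubic vertex \<open>f\<close> in the boundary, remains.
\<close>

lemma end_cases:
  assumes A: "end_of S A" and S: "S \<subseteq> E" "\<And>e. e \<in> S \<Longrightarrow> separating e"
    and e': "e' \<in> S" "e' \<inter> A \<noteq> {}"
  shows "card A = 1 \<or> e' \<subseteq> A \<and> (\<exists>f\<in>nbrs A. \<exists>u\<in>V - A - nbrs A. nbrs {f} = insert u e' \<and> nbrs A - {f} \<in> S)"
proof (cases "card A = 1")
  case False
  obtain e where e: "e \<in> S" "e \<subseteq> nbrs A" and fA: "fragment A"
    using A by (auto simp: end_of_def frag_of_def)
  obtain F where fF: "fragment F" and eF: "e' \<subseteq> nbrs F"
    using S(2)[OF e'(1)] by (auto simp: separating_def)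
  define T where "T = nbrs A"
  define U where "U = nbrs F"
  define B where "B = V - A - T"
  define D where "D = V - F - U"
  have fB: "fragment B" and TB: "nbrs B = T"
    using fragment_co[OF fA] by (auto simp: B_def T_def)
  have fD: "fragment D" and UD: "nbrs D = U"
    using fragment_co[OF fF] by (auto simp: D_def U_def)
  have card3: "card T = 3" "card U = 3" using fA fF by (auto simp: fragment_def T_def U_def)
  have sub: "A \<subseteq> V" "B \<subseteq> V" "F \<subseteq> V" "D \<subseteq> V" "T \<subseteq> V" "U \<subseteq> V"
    using fA fF nbrs_subset by (auto simp: fragment_def T_def U_def B_def D_def)
  note fin = finite_subset[OF sub(1) finV] finite_subset[OF sub(2) finV]
    finite_subset[OF sub(3) finV] finite_subset[OF sub(4) finV]
    finite_subset[OF sub(5) finV] finite_subset[OF sub(6) finV]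
  have ne: "A \<noteq> {}" "B \<noteq> {}" "F \<noteq> {}" "D \<noteq> {}" using fA fB fF fD by (auto simp: fragment_def)
  have disj: "A \<inter> T = {}" "F \<inter> U = {}" "A \<inter> B = {}" "F \<inter> D = {}" "B \<inter> T = {}" "D \<inter> U = {}"
    using nbrs_disjoint by (auto simp: T_def U_def B_def D_def)
  have VA: "V = A \<union> T \<union> B" and VF: "V = F \<union> U \<union> D" using sub by (auto simp: B_def D_def)
  have sum_A: "card X = card (X \<inter> A) + card (X \<inter> T) + card (X \<inter> B)" if "finite X" "X \<subseteq> V" for X
    by (rule card_split3[OF that VA]) (use disj in auto)
  have sum_F: "card X = card (X \<inter> F) + card (X \<inter> U) + card (X \<inter> D)" if "finite X" "X \<subseteq> V" for X
    by (rule card_split3[OF that VF]) (use disj in auto)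
  have e'AT: "e' \<subseteq> A \<union> T"
  proof -
    obtain x y where xy: "e' = {x, y}" "{x, y} \<in> E"
      using edgeE[of e'] S(1) e'(1) by blast
    then show ?thesis using e'(2) closed_nbr[of x y A] closed_nbr[of y x A]
      unfolding T_def by (auto simp: insert_commute)
  qed
  \<comment> \<open>Minimality enters here: a corner in \<open>A\<close> bounded by 3 vertices would
    be a smaller fragment with \<open>e'\<close> in its boundary. Hence the bound 4.\<close>
  have not_corner: "card (T \<inter> X) + card (T \<inter> U) + card (U \<inter> A) \<ge> 4"
    if X: "fragment X" "nbrs X = U" "A \<inter> X \<noteq> {}" for X
  proof (rule ccontr)
    assume "\<not> ?thesis"
    then have *: "fragment (A \<inter> X)" "nbrs (A \<inter> X) = T \<inter> X \<union> T \<inter> U \<union> U \<inter> A"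
      using corner[OF fA X(1) X(3)] X(2) by (auto simp: T_def)
    have "e' \<subseteq> nbrs (A \<inter> X)" using e'AT eF unfolding * by (auto simp: U_def)
    then have "frag_of S (A \<inter> X)" using * e'(1) by (auto simp: frag_of_def)
    moreover have "A \<inter> X \<subset> A" using e'(2) eF nbrs_disjoint[of X] X(2) by (auto simp: U_def)
    ultimately show False using A by (auto simp: end_of_def)
  qed
  \<comment> \<open>A vertex of \<open>T\<close> has a neighbour in \<open>B\<close>; seen from
    inside \<open>X\<close>, this neighbour is in \<open>X\<close> or in \<open>U\<close>.\<close>
  have reach: "U \<inter> B \<noteq> {}" if X: "nbrs X = U" "T \<inter> X \<noteq> {}" "B \<inter> X = {}" for X
  proof -
    obtain f where f: "f \<in> T" "f \<in> X" using X(2) by blast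
    then obtain v where v: "v \<in> B" "{f, v} \<in> E" using TB by (auto simp: nbrs_def)
    then show ?thesis using closed_nbr[OF v(2) f(2)] X by blast
  qed
  have num: "card (U \<inter> A) = 2 \<and> card (U \<inter> B) = 1 \<and> card (T \<inter> U) = 0 \<and>
      (card F = 1 \<and> card (T \<inter> F) = 1 \<or> card D = 1 \<and> card (T \<inter> D) = 1)"
  proof (rule corner_arith)
    show "card A \<ge> 2" using False ne(1) fin(1)
      by (metis One_nat_def Suc_1 Suc_leI card_0_eq le_neq_implies_less not_gr_zero)
    show "card F \<ge> 1" "card D \<ge> 1" "card B \<ge> 1" using ne fin by (auto simp: Suc_le_eq card_gt_0_iff)
    have "U \<inter> A \<noteq> {}" using e'(2) eF by (auto simp: U_def)
    then show "card (U \<inter> A) \<ge> 1" using fin by (auto simp: Suc_le_eq card_gt_0_iff)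
    show "card A = card (A \<inter> F) + card (U \<inter> A) + card (A \<inter> D)"
      using sum_F[OF fin(1) sub(1)] by (simp add: Int_commute)
    show "card B = card (B \<inter> F) + card (U \<inter> B) + card (B \<inter> D)"
      using sum_F[OF fin(2) sub(2)] by (simp add: Int_commute)
    show "3 = card (T \<inter> F) + card (T \<inter> U) + card (T \<inter> D)"
      using sum_F[OF fin(5) sub(5)] card3 by (simp add: Int_commute)
    show "card F = card (A \<inter> F) + card (T \<inter> F) + card (B \<inter> F)"
      using sum_A[OF fin(3) sub(3)] by (simp add: Int_commute)
    show "card D = card (A \<inter> D) + card (T \<inter> D) + card (B \<inter> D)"
      using sum_A[OF fin(4) sub(4)] by (simp add: Int_commute)
    show "3 = card (U \<inter> A) + card (T \<inter> U) + card (U \<inter> B)"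
      using sum_A[OF fin(6) sub(6)] card3 by (simp add: Int_commute)
    show "card (A \<inter> F) > 0 \<Longrightarrow> card (T \<inter> F) + card (T \<inter> U) + card (U \<inter> A) \<ge> 4"
      using not_corner[OF fF U_def[symmetric]] by (auto simp: card_gt_0_iff)
    show "card (A \<inter> D) > 0 \<Longrightarrow> card (T \<inter> D) + card (T \<inter> U) + card (U \<inter> A) \<ge> 4"
      using not_corner[OF fD UD] by (auto simp: card_gt_0_iff)
    show "card (B \<inter> F) > 0 \<Longrightarrow> card (T \<inter> F) + card (T \<inter> U) + card (U \<inter> B) \<ge> 3"
      using corner(1)[OF fB fF] by (auto simp: TB U_def card_gt_0_iff)
    show "card (B \<inter> D) > 0 \<Longrightarrow> card (T \<inter> D) + card (T \<inter> U) + card (U \<inter> B) \<ge> 3"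
      using corner(1)[OF fB fD] by (auto simp: TB UD card_gt_0_iff)
    show "card (B \<inter> F) = 0 \<Longrightarrow> card (T \<inter> F) > 0 \<Longrightarrow> card (U \<inter> B) > 0"
      using reach[OF U_def[symmetric]] fin by (auto simp: card_gt_0_iff)
    show "card (B \<inter> D) = 0 \<Longrightarrow> card (T \<inter> D) > 0 \<Longrightarrow> card (U \<inter> B) > 0"
      using reach[OF UD] fin by (auto simp: card_gt_0_iff)
  qed
  \<comment> \<open>One of \<open>F\<close> and \<open>D\<close> is a single vertex of
    \<open>T\<close>, which is thus cubic with neighbourhood \<open>U\<close>.\<close>
  then obtain X where X: "nbrs X = U" "card X = 1" "card (T \<inter> X) = 1"
    using UD U_def by blast
  then obtain f where f: "X = {f}" by (meson card_1_singletonE)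
  then have fT: "f \<in> T" using X(3) by (auto simp: Int_insert_right split: if_splits)
  obtain u where u: "U \<inter> B = {u}" using num by (meson card_1_singletonE)
  have TU: "T \<inter> U = {}" using num fin by simp
  have e'UA: "e' \<subseteq> U \<inter> A" using e'AT eF TU by (auto simp: U_def)
  have card_edge: "card g = 2" if "g \<in> S" for g
    using edgeE[of g] S(1) that by (metis card_2_iff subsetD)
  have "e' = U \<inter> A"
    by (rule card_subset_eq[OF _ e'UA]) (use fin num card_edge[OF e'(1)] in auto)
  then have Uu: "U = insert u e'" using u TU sub(6) VA by blast
  \<comment> \<open>As \<open>T\<close> and \<open>U\<close> are disjoint, \<open>f\<close> has no
    neighbour in \<open>T\<close>.\<close>
  have "f \<notin> e"
  proof
    assume "f \<in> e"
    then obtain g where "e = {f, g}" "{f, g} \<in> E"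
      using edgeE[of e] S(1) e(1) by (metis (no_types) insert_commute insert_iff singletonD subsetD)
    then show False using nbrs_vertex[of g f] X(1) f e(2) TU by (auto simp: T_def)
  qed
  then have "e \<subseteq> T - {f}" using e(2) by (auto simp: T_def)
  moreover have "card (T - {f}) = card e" using card_edge[OF e(1)] card3 fT by simp
  ultimately have "e = T - {f}" using fin by (intro card_subset_eq) auto
  moreover have "u \<in> V - A - nbrs A" using u by (auto simp: B_def T_def)
  moreover have "nbrs {f} = insert u e'" using X(1) f Uu by simp
  ultimately show ?thesis using e(1) e'UA fT unfolding T_def by blast
qed simp

end

section \<open>Depth-first search trees of 3-connected graphs\<close>

locale dfs3 = conn3 V E for V :: "'a set" and E :: "'a set set" +
  fixes Q :: "'a set set" and r :: 'a
  assumes QE: "Q \<subseteq> E"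
    and connQ: "X \<subseteq> V \<Longrightarrow> X \<noteq> {} \<Longrightarrow> X \<noteq> V \<Longrightarrow> \<exists>x\<in>X. \<exists>y\<in>V - X. {x, y} \<in> Q"
    and cutQ: "{z, u} \<in> Q \<Longrightarrow>
      \<exists>D\<subseteq>V. z \<in> D \<and> u \<notin> D \<and> (\<forall>x\<in>D. \<forall>y\<in>V - D. {x, y} \<in> Q \<longrightarrow> x = z \<and> y = u)"
    \<comment> \<open>\<open>X\<close> and \<open>Y\<close> are unions of \<open>x\<close>-branches, given by closure under \<open>Q\<close>-edges avoiding \<open>x\<close>.\<close>
    and dfs: "x \<in> V \<Longrightarrow> X \<subseteq> V - {x} \<Longrightarrow> Y \<subseteq> V - {x} \<Longrightarrow> X \<inter> Y = {} \<Longrightarrow> r \<notin> X \<union> Y \<Longrightarrow>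
      (\<And>a b. a \<in> X \<Longrightarrow> {a, b} \<in> Q \<Longrightarrow> b \<in> insert x X) \<Longrightarrow>
      (\<And>a b. a \<in> Y \<Longrightarrow> {a, b} \<in> Q \<Longrightarrow> b \<in> insert x Y) \<Longrightarrow> a \<in> X \<Longrightarrow> b \<in> Y \<Longrightarrow> {a, b} \<notin> E"
    and rV: "r \<in> V"
begin

text \<open>A leaf of the undirected tree with its tree neighbour; the root may be a leaf as well,
  and the proof has to locate it.\<close>

definition leaf :: "'a \<Rightarrow> 'a \<Rightarrow> bool" where
  "leaf q p \<longleftrightarrow> {q, p} \<in> Q \<and> (\<forall>x. {q, x} \<in> Q \<longrightarrow> x = p)"

definition sep_edges :: "'a set set" where "sep_edges = {e \<in> Q. separating e}"

definition leaf_sep_edges :: "'a set set" where "leaf_sep_edges = {e \<in> sep_edges. \<exists>q p. leaf q p \<and> e = {q, p}}"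

lemma sep_edges_E: "sep_edges \<subseteq> E" "\<And>e. e \<in> sep_edges \<Longrightarrow> separating e" "leaf_sep_edges \<subseteq> E" "\<And>e. e \<in> leaf_sep_edges \<Longrightarrow> separating e"
  using QE by (auto simp: sep_edges_def leaf_sep_edges_def)

lemma Q_ends: "{x, y} \<in> Q \<Longrightarrow> x \<in> V \<and> y \<in> V \<and> x \<noteq> y"
  using edge_ends QE by blast

lemma Q_sym: "{x, y} \<in> Q \<Longrightarrow> {y, x} \<in> Q"
  by (simp add: insert_commute)

text \<open>Contrapositive of \<open>dfs\<close>: edges of the graph are used to trap the
  root.\<close>

lemma dfs_root:
  assumes "x \<in> V" "X \<subseteq> V - {x}" "Y \<subseteq> V - {x}" "X \<inter> Y = {}"
    "\<forall>a\<in>X. \<forall>b. {a, b} \<in> Q \<longrightarrow> b \<in> insert x X" "\<forall>a\<in>Y. \<forall>b. {a, b} \<in> Q \<longrightarrow> b \<in> insert x Y"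
    "a \<in> X" "b \<in> Y" "{a, b} \<in> E"
  shows "r \<in> X \<union> Y"
proof (rule ccontr)
  assume "\<not> ?thesis"
  then have "{a, b} \<notin> E"
    by (intro dfs[of x X Y]) (use assms in blast)+
  then show False using assms(9) by blast
qed

lemma closed_eq_V:
  assumes "X \<subseteq> V" "X \<noteq> {}" "\<And>a b. a \<in> X \<Longrightarrow> {a, b} \<in> Q \<Longrightarrow> b \<in> X" shows "X = V"
  using connQ[of X] assms by blast

lemma Q_nbr: "x \<in> V \<Longrightarrow> \<exists>y. {x, y} \<in> Q"
proof -
  assume x: "x \<in> V"
  have "{x} \<noteq> V" using card_V by auto
  then show ?thesis using connQ[of "{x}"] x by blast
qed

text \<open>Cut the tree at \<open>{b, x}\<close>: wherever \<open>y\<close> falls, one of the other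
  two edges crosses the cut.\<close>

lemma no_triangle: "{b, x} \<in> Q \<Longrightarrow> {b, y} \<in> Q \<Longrightarrow> {x, y} \<in> Q \<Longrightarrow> False"
proof -
  assume Q: "{b, x} \<in> Q" "{b, y} \<in> Q" "{x, y} \<in> Q"
  obtain D where D: "b \<in> D" "x \<notin> D" "\<forall>v\<in>D. \<forall>w\<in>V - D. {v, w} \<in> Q \<longrightarrow> v = b \<and> w = x"
    using cutQ[OF Q(1)] by blast
  show False using D Q Q_ends[OF Q(1)] Q_ends[OF Q(2)] Q_ends[OF Q(3)] Q_sym[OF Q(3)]
    by (cases "y \<in> D") blast+
qed

lemma card_nbrs_le2: "X \<subseteq> V \<Longrightarrow> X \<noteq> {} \<Longrightarrow> nbrs X \<subseteq> {a, b} \<Longrightarrow> V - X - {a, b} \<noteq> {} \<Longrightarrow> False"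
proof -
  assume X: "X \<subseteq> V" "X \<noteq> {}" "nbrs X \<subseteq> {a, b}" "V - X - {a, b} \<noteq> {}"
  have "card (nbrs X) \<le> card {a, b}" using X(3) by (intro card_mono) auto
  also have "\<dots> \<le> 2" by (simp add: card_insert_if)
  finally show False using card_nbrs_ge[OF X] by simp
qed

lemma degree_ge3: "v \<in> V \<Longrightarrow> nbrs {v} \<subseteq> {a, b} \<Longrightarrow> False"
proof -
  assume X: "v \<in> V" "nbrs {v} \<subseteq> {a, b}"
  have "card (nbrs {v}) \<le> card {a, b}" using X(2) by (intro card_mono) auto
  also have "\<dots> \<le> 2" by (simp add: card_insert_if)
  finally show False using card_nbrs_vertex[OF X(1)] by simp
qed

text \<open>If \<open>b\<close> is the root, then \<open>{y}\<close> and the set of all vertices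
  other than \<open>x\<close>, \<open>b\<close>, \<open>y\<close> are unions of
  \<open>x\<close>-branches. So \<open>y\<close> has no neighbours besides \<open>x\<close> and
  \<open>b\<close>.\<close>

lemma root_not_adjacent_leaf:
  assumes "leaf b x" "leaf y x" "{b, y} \<in> E" shows "r \<noteq> b"
proof
  assume rb: "r = b"
  have V: "x \<in> V" "b \<in> V" "y \<in> V" "b \<noteq> y" "x \<noteq> b" "x \<noteq> y"
    using assms Q_ends edge_ends unfolding leaf_def by blast+
  let ?Y = "V - {x, b, y}"
  have "{y, w} \<notin> E" if "w \<in> ?Y" for w
  proof (rule dfs[of x "{y}" ?Y])
    show "c \<in> insert x ?Y" if "a \<in> ?Y" "{a, c} \<in> Q" for a c
      using that assms(1,2) Q_ends[OF that(2)] Q_sym[OF that(2)] unfolding leaf_def by blast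
  qed (use V rb assms that in \<open>auto simp: leaf_def\<close>)
  then have "nbrs {y} \<subseteq> {x, b}" using edge_ends[of y] by (fastforce simp: nbrs_vertex)
  then show False using degree_ge3[OF V(3)] by blast
qed

text \<open>If neither leaf is the root, both are \<open>x\<close>-branches.\<close>

lemma not_adjacent_leaves: "leaf b x \<Longrightarrow> leaf y x \<Longrightarrow> {b, y} \<notin> E"
proof
  assume l: "leaf b x" "leaf y x" "{b, y} \<in> E"
  then have "r \<noteq> b" "r \<noteq> y" using root_not_adjacent_leaf by (metis insert_commute)+
  moreover have "x \<in> V" "b \<in> V" "y \<in> V" "b \<noteq> y" "x \<noteq> b" "x \<noteq> y"
    using l Q_ends edge_ends unfolding leaf_def by blast+
  ultimately show False using dfs[of x "{b}" "{y}" b y] l by (auto simp: leaf_def)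
qed

text \<open>Walk away from \<open>u\<close>: if \<open>z\<close> is not a leaf, another tree edge at
  \<open>z\<close> leads to a smaller side.\<close>

lemma leaf_in_side:
  assumes "{z, u} \<in> Q" "D \<subseteq> V" "z \<in> D" "u \<notin> D"
    "\<And>x y. x \<in> D \<Longrightarrow> y \<in> V - D \<Longrightarrow> {x, y} \<in> Q \<Longrightarrow> x = z \<and> y = u"
  shows "\<exists>l\<in>D. \<exists>m. leaf l m"
proof -
  have "finite D" using assms(2) finV finite_subset by blast
  then show ?thesis using assms
  proof (induction D arbitrary: z u rule: finite_psubset_induct)
    case (psubset D)
    note P = psubset.prems
    show ?case
    proof (cases "leaf z u")
      case False
      then obtain w where w: "{z, w} \<in> Q" "w \<noteq> u" using P(1) by (auto simp: leaf_def)
      then have wD: "w \<in> D" using P(5)[of z w] P(3) Q_ends by blast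
      obtain D2 where D2: "D2 \<subseteq> V" "w \<in> D2" "z \<notin> D2"
        "\<forall>x\<in>D2. \<forall>y\<in>V - D2. {x, y} \<in> Q \<longrightarrow> x = w \<and> y = z"
        using cutQ[OF Q_sym[OF w(1)]] by blast
      have "\<exists>l\<in>D2 \<inter> D. \<exists>m. leaf l m"
      proof (rule psubset.IH[of "D2 \<inter> D" w z])
        show "D2 \<inter> D \<subset> D" using P(3) D2(3) by blast
        show "x = w \<and> y = z" if "x \<in> D2 \<inter> D" "y \<in> V - D2 \<inter> D" "{x, y} \<in> Q" for x y
          using that D2 P(5)[of x y] by blast
      qed (use Q_sym[OF w(1)] D2 wD P in auto)
      then show ?thesis by blast
    qed (use P(3) in blast)
  qed
qed

text \<open>Take a leaf on each side of a tree edge. If their leaf edges coincided, this edge would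
  be the whole tree.\<close>

lemma two_leaf_edges:
  "\<exists>q p q' p'. leaf q p \<and> leaf q' p' \<and> {q, p} \<noteq> {q', p'}"
proof -
  obtain z u where zu: "{z, u} \<in> Q" using rV Q_nbr by blast
  obtain D where D: "D \<subseteq> V" "z \<in> D" "u \<notin> D"
    "\<forall>x\<in>D. \<forall>y\<in>V - D. {x, y} \<in> Q \<longrightarrow> x = z \<and> y = u"
    using cutQ[OF zu] by blast
  have "\<exists>l\<in>D. \<exists>m. leaf l m"
    by (rule leaf_in_side[OF zu]) (use D in auto)
  then obtain q p where q: "q \<in> D" "leaf q p" by blast
  have "\<exists>l\<in>V - D. \<exists>m. leaf l m"
    by (rule leaf_in_side[OF Q_sym[OF zu]]) (use D Q_sym Q_ends[OF zu] in blast)+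
  then obtain q' p' where q': "q' \<in> V - D" "leaf q' p'" by blast
  have "{q, p} \<noteq> {q', p'}"
  proof
    assume "{q, p} = {q', p'}"
    then have pq: "p = q'" "p' = q" using q(1) q'(1) by (auto simp: doubleton_eq_iff)
    have "{q, q'} = V"
      by (rule closed_eq_V) (use q q' D(1) pq in \<open>auto simp: leaf_def\<close>)
    then have "card V \<le> 2" by (auto simp: card_insert_if)
    then show False using card_V by simp
  qed
  then show ?thesis using q q' by blast
qed

section \<open>Ends and the exceptional configuration\<close>

text \<open>The neighbourhood of \<open>b\<close> consists of the ends of \<open>e\<close> and a
  vertex \<open>z\<close>. By \<open>not_separating\<close> the edge to \<open>z\<close> is
  nonseparating, so it is not in \<open>Q\<close>; and \<open>Q\<close> cannot join \<open>b\<close>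
  to both ends of its own edge \<open>e\<close>.\<close>

lemma cubic_leaf:
  assumes "card A = 1" "end_of T A" "T \<subseteq> sep_edges" "\<And>e. e \<in> Q \<Longrightarrow> e \<inter> A \<noteq> {} \<Longrightarrow> e \<in> sep_edges"
  obtains b x y where "A = {b}" "leaf b x" "{x, y} \<in> T" "{b, y} \<in> E"
proof -
  obtain b where b: "A = {b}" using assms(1) by (meson card_1_singletonE)
  obtain e where e: "e \<in> T" "e \<subseteq> nbrs {b}" and c3: "card (nbrs {b}) = 3" and bV: "b \<in> V"
    using assms(2) b by (auto simp: end_of_def frag_of_def fragment_def)
  have "e \<in> Q" using e assms(3) by (auto simp: sep_edges_def)
  then obtain x y where xy: "e = {x, y}" "x \<noteq> y" "{x, y} \<in> Q" using QE edgeE by blast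
  have "card (nbrs {b} - e) = 1" using c3 e(2) xy by (simp add: card_Diff_subset)
  then obtain z where z: "nbrs {b} - e = {z}" by (meson card_1_singletonE)
  then have N: "nbrs {b} = {x, y, z}" using e(2) xy by auto
  have "\<not> separating {b, z}" using not_separating[OF N] xy(3) QE by blast
  then have "{b, z} \<notin> Q" using assms(4)[of "{b, z}"] b by (auto simp: sep_edges_def)
  moreover have "{b, x} \<notin> Q \<or> {b, y} \<notin> Q" using no_triangle xy(3) by blast
  moreover have "w \<in> {x, y, z}" if "{b, w} \<in> Q" for w using that QE N nbrs_vertex[of w b] by blast
  ultimately have "leaf b x \<or> leaf b y" using Q_nbr[OF bV] unfolding leaf_def by blast
  moreover have "{b, x} \<in> E" "{b, y} \<in> E" using N nbrs_vertex[of _ b] by auto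
  ultimately show ?thesis using that b e(1) xy(1) by (metis insert_commute)
qed

text \<open>The second alternative of \<open>end_cases\<close>, where the edge inside the end is a
  leaf edge and \<open>{z, u}\<close> is a nonseparating tree edge.\<close>

definition exceptional :: "'a set \<Rightarrow> 'a \<Rightarrow> 'a \<Rightarrow> 'a \<Rightarrow> 'a \<Rightarrow> bool" where
  "exceptional A z u p q \<longleftrightarrow> end_of leaf_sep_edges A \<and> leaf q p \<and> p \<in> A \<and> q \<in> A \<and> {p, q} \<in> leaf_sep_edges \<and>
     nbrs {z} = {p, q, u} \<and> z \<in> nbrs A \<and> u \<in> V - A - nbrs A \<and> nbrs A - {z} \<in> leaf_sep_edges \<and>
     {z, u} \<in> Q \<and> \<not> separating {z, u}"

lemma end_exceptional:
  assumes A: "end_of leaf_sep_edges A" and hit: "\<And>e. e \<in> Q \<Longrightarrow> e \<inter> A \<noteq> {} \<Longrightarrow> e \<in> sep_edges"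
  shows "\<exists>z u p q. exceptional A z u p q"
proof -
  have leaf_sub: "leaf_sep_edges \<subseteq> sep_edges" by (auto simp: leaf_sep_edges_def)
  have "frag_of sep_edges A" using A leaf_sub by (auto simp: end_of_def frag_of_def)
  then obtain B where B: "end_of sep_edges B" "B \<subseteq> A" by (rule end_exists)
  have hitB: "e \<in> sep_edges" if "e \<in> Q" "e \<inter> B \<noteq> {}" for e using that hit B(2) by blast
  have fB: "B \<subseteq> V" "B \<noteq> {}" "B \<noteq> V" using B(1) by (auto simp: end_of_def frag_of_def fragment_def)
  \<comment> \<open>\<open>B\<close> is an end for all separating tree edges, so
    \<open>end_cases\<close> applies to this edge; as it is not contained in \<open>B\<close>, only
    the alternative \<open>card B = 1\<close> remains.\<close>
  obtain b c where bc: "b \<in> B" "c \<notin> B" "{b, c} \<in> Q" using connQ[OF fB] by blast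
  have "card B = 1"
    using end_cases[OF B(1) sep_edges_E(1,2), of "{b, c}"] hitB[of "{b, c}"] bc by blast
  then obtain b x y where b: "B = {b}" "leaf b x" using cubic_leaf[OF _ B(1) _ hitB] by blast
  have bx: "{b, x} \<in> leaf_sep_edges" "b \<in> A" using b hitB[of "{b, x}"] B(2) by (auto simp: leaf_sep_edges_def leaf_def)
  \<comment> \<open>Otherwise the boundary of \<open>{b}\<close> contains a leaf edge at
    \<open>x\<close>, and its other end is a leaf at \<open>x\<close> adjacent to the leaf
    \<open>b\<close>.\<close>
  have "card A \<noteq> 1"
  proof
    assume "card A = 1"
    then obtain b' x' y' where b': "A = {b'}" "leaf b' x'" "{x', y'} \<in> leaf_sep_edges" "{b', y'} \<in> E"
      using cubic_leaf[OF _ A leaf_sub hit] by blast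
    then have "b' = b" using bx(2) by simp
    then have "x' = x" using b(2) b'(2) by (auto simp: leaf_def)
    obtain q p where qp: "leaf q p" "{x', y'} = {q, p}" using b'(3) by (auto simp: leaf_sep_edges_def)
    have "\<not> leaf x' y'" using b'(2) edge_ends[OF b'(4)] Q_sym[of b' x'] by (auto simp: leaf_def)
    then have "leaf y' x'" using qp by (auto simp: doubleton_eq_iff)
    then show False using not_adjacent_leaves b'(2,4) by blast
  qed
  then obtain f u where f: "f \<in> nbrs A" "u \<in> V - A - nbrs A" "nbrs {f} = insert u {b, x}"
    "nbrs A - {f} \<in> leaf_sep_edges" and sub: "{b, x} \<subseteq> A"
    using end_cases[OF A sep_edges_E(3,4) bx(1)] bx(2) by blast
  have N: "nbrs {f} = {x, b, u}" using f(3) by auto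
  have xb: "{x, b} \<in> Q" using b(2) Q_sym by (auto simp: leaf_def)
  have ns: "\<not> separating {f, u}" using not_separating[OF N] xb QE by blast
  have fV: "f \<in> V" using f(1) nbrs_subset by blast
  have fQ: "w \<in> {x, b, u}" if "{f, w} \<in> Q" for w using that QE N nbrs_vertex[of w f] by blast
  \<comment> \<open>Otherwise \<open>f\<close> would be a leaf at \<open>x\<close> adjacent to the
    leaf \<open>b\<close>.\<close>
  have "{f, u} \<in> Q"
  proof (rule ccontr)
    assume "{f, u} \<notin> Q"
    moreover have "{f, b} \<notin> Q"
      using b(2) Q_sym[of f b] f(1) sub nbrs_disjoint[of A] unfolding leaf_def by blast
    ultimately have "leaf f x" using fQ Q_nbr[OF fV] unfolding leaf_def by blast
    moreover have "{b, f} \<in> E" using N nbrs_vertex[of b f] by (auto simp: insert_commute)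
    ultimately show False using not_adjacent_leaves b(2) by blast
  qed
  then have "exceptional A f u x b"
    unfolding exceptional_def using A b(2) sub bx(1) N f ns by (auto simp: insert_commute)
  then show ?thesis by blast
qed

lemma exceptional_pair:
  assumes H: "\<And>e f. e \<in> Q - sep_edges \<Longrightarrow> f \<in> Q - sep_edges \<Longrightarrow> e = f"
  shows "\<exists>A A' z u p q p' q'. exceptional A z u p q \<and> exceptional A' u z p' q' \<and> {p, q} \<inter> {p', q'} = {}"
proof -
  obtain q1 p1 q2 p2 where l: "leaf q1 p1" "leaf q2 p2" "{q1, p1} \<noteq> {q2, p2}"
    using two_leaf_edges by blast
  then have "{q1, p1} \<in> leaf_sep_edges \<or> {q2, p2} \<in> leaf_sep_edges"
    using H[of "{q1, p1}" "{q2, p2}"] unfolding leaf_sep_edges_def leaf_def by blast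
  then obtain e F where e: "e \<in> leaf_sep_edges" "fragment F" "e \<subseteq> nbrs F"
    using sep_edges_E(4) unfolding separating_def by blast
  let ?F' = "V - F - nbrs F"
  have fr: "frag_of leaf_sep_edges F" "frag_of leaf_sep_edges ?F'" using e fragment_co[OF e(2)] by (auto simp: frag_of_def)
  obtain A1 where A1: "end_of leaf_sep_edges A1" "A1 \<subseteq> F" by (rule end_exists[OF fr(1)])
  obtain A2 where A2: "end_of leaf_sep_edges A2" "A2 \<subseteq> ?F'" by (rule end_exists[OF fr(2)])
  note A12 = A1 A2
  \<comment> \<open>Otherwise the ends on both sides meet nonseparating tree edges, by
    \<open>H\<close> the same one, which would join \<open>F\<close> to its far side.\<close>
  have "\<exists>z u p q A. exceptional A z u p q"
  proof (rule ccontr)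
    assume no: "\<not> ?thesis"
    have hit: "\<exists>g. g \<in> Q - sep_edges \<and> g \<inter> B \<noteq> {}" if B: "end_of leaf_sep_edges B" for B
    proof (rule ccontr)
      assume "\<not> ?thesis"
      then have "e \<in> sep_edges" if "e \<in> Q" "e \<inter> B \<noteq> {}" for e using that by blast
      from end_exceptional[OF B this] no show False by blast
    qed
    obtain g where g: "g \<in> Q - sep_edges" "g \<inter> A1 \<noteq> {}" using hit[OF A12(1)] by blast
    obtain h where h: "h \<in> Q - sep_edges" "h \<inter> A2 \<noteq> {}" using hit[OF A12(3)] by blast
    have "h = g" using H[OF h(1) g(1)] .
    obtain s where s: "s \<in> g" "s \<in> F" using g A12 by blast
    obtain t where t: "t \<in> g" "t \<in> ?F'" using h A12 \<open>h = g\<close> by blast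
    have "g \<in> E" using g QE by blast
    then have "{s, t} \<in> E" using s t edgeE[of g] by (auto simp: insert_commute)
    then show False using closed_nbr s(2) t(2) by blast
  qed
  then obtain A z u p q where A: "exceptional A z u p q" by blast
  then have A_facts: "nbrs {z} = {p, q, u}" "{p, q} \<in> leaf_sep_edges" "{z, u} \<in> Q - sep_edges" "leaf q p" "z \<in> nbrs A"
    "p \<in> A" "q \<in> A" "u \<notin> A"
    by (auto simp: exceptional_def sep_edges_def)
  \<comment> \<open>The far side of the fragment \<open>{z}\<close> has the leaf edge
    \<open>{p, q}\<close> in its boundary. An end inside it avoids \<open>z\<close> and
    \<open>u\<close>, hence the only nonseparating tree edge, so it is exceptional too.\<close>
  let ?G = "V - {z} - {p, q, u}"
  have zV: "z \<in> V" using A_facts(5) nbrs_subset by blast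
  have "card {p, q, u} \<ge> 3" using card_nbrs_vertex[OF zV] A_facts(1) by simp
  moreover have "card {p, q, u} \<le> 3" by (simp add: card_insert_if)
  ultimately have c3: "card {p, q, u} = 3" by simp
  have "card (V - ({z} \<union> {p, q, u})) > 0"
  proof -
    have "card ({z} \<union> {p, q, u}) \<le> 4" using card_Un_le[of "{z}" "{p, q, u}"] c3 by simp
    then have "card V - card ({z} \<union> {p, q, u}) > 0" using card_V by linarith
    then show ?thesis using diff_card_le_card_Diff[of "{z} \<union> {p, q, u}" V] by auto
  qed
  then have "?G \<noteq> {}" by (metis Diff_insert2 card.empty insert_is_Un less_irrefl Diff_insert)
  then have fz: "fragment {z}" using zV c3 A_facts(1) by (auto simp: fragment_def)
  have "fragment ?G" "nbrs ?G = {p, q, u}" using fragment_co[OF fz] A_facts(1) by auto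
  moreover have "{p, q} \<subseteq> {p, q, u}" by blast
  ultimately have "frag_of leaf_sep_edges ?G" using A_facts(2) unfolding frag_of_def by metis
  then obtain A' where A': "end_of leaf_sep_edges A'" "A' \<subseteq> ?G" by (rule end_exists)
  have hit: "e \<in> sep_edges" if "e \<in> Q" "e \<inter> A' \<noteq> {}" for e
  proof (rule ccontr)
    assume "e \<notin> sep_edges"
    then have "e = {z, u}" using H[of e "{z, u}"] that A_facts(3) by blast
    then show False using that A'(2) by blast
  qed
  then obtain z' u' p' q' where ex: "exceptional A' z' u' p' q'"
    using end_exceptional[OF A'(1) hit] by blast
  have "{z', u'} \<in> Q - sep_edges" using ex by (auto simp: exceptional_def sep_edges_def)
  then have eq: "{z', u'} = {z, u}" using H A_facts(3) by simp
  have pq': "p' \<in> A'" "q' \<in> A'" "nbrs {z'} = {p', q', u'}" using ex by (auto simp: exceptional_def)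
  \<comment> \<open>\<open>z'\<close> has neighbours in \<open>A'\<close>, whereas all neighbours of
    \<open>z\<close> lie outside \<open>?G\<close>. So the second configuration sits at the other
    end of the edge.\<close>
  have "z' \<noteq> z" using pq' A'(2) A_facts(1) by blast
  then have "z' = u" "u' = z" using eq by (auto simp: doubleton_eq_iff)
  then have "exceptional A' u z p' q'" using ex by simp
  moreover have "{p, q} \<inter> {p', q'} = {}" using pq' A'(2) by blast
  ultimately show ?thesis using A by blast
qed

section \<open>Two triangles joined by a tree edge\<close>

text \<open>What two exceptional ends leave once the ends are forgotten: triangles on
  \<open>z\<close>, \<open>p\<close>, \<open>q\<close> and on \<open>u\<close>, \<open>p'\<close>,
  \<open>q'\<close>. Its symmetry lets one argument serve both halves.\<close>

definition dumbbell :: "'a \<Rightarrow> 'a \<Rightarrow> 'a \<Rightarrow> 'a \<Rightarrow> 'a \<Rightarrow> 'a \<Rightarrow> bool" where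
  "dumbbell z u p q p' q' \<longleftrightarrow> {z, u} \<in> Q \<and> nbrs {z} = {p, q, u} \<and> nbrs {u} = {p', q', z} \<and>
     leaf q p \<and> leaf q' p' \<and> distinct [z, u, p, q, p', q'] \<and> {z, u, p, q, p', q'} \<subseteq> V"

lemma dumbbell_sym: "dumbbell z u p q p' q' \<Longrightarrow> dumbbell u z p' q' p q"
  by (auto simp: dumbbell_def insert_commute)

lemma exceptional_six:
  assumes "exceptional A z u p q" "exceptional A' u z p' q'" "{p, q} \<inter> {p', q'} = {}"
  shows "dumbbell z u p q p' q'"
proof -
  have N: "nbrs {z} = {p, q, u}" "nbrs {u} = {p', q', z}" "leaf q p" "leaf q' p'" "{z, u} \<in> Q"
    "p \<in> A" "q \<in> A" "u \<notin> A" "p' \<in> A'" "q' \<in> A'" "z \<notin> A'"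
    using assms by (auto simp: exceptional_def)
  have "z \<in> V" "u \<in> V" "z \<noteq> u" "q \<noteq> p" "q' \<noteq> p'"
    using N(3,4,5) Q_ends unfolding leaf_def by blast+
  moreover have "{p, q, u} \<subseteq> V - {z}" "{p', q', z} \<subseteq> V - {u}" using N(1,2) by (auto simp: nbrs_def)
  ultimately show ?thesis unfolding dumbbell_def using N assms(3) by auto
qed

text \<open>Otherwise \<open>z\<close> is a leaf at \<open>u\<close>, and \<open>{z, u}\<close>,
  \<open>{q'}\<close> and the remaining vertices are three sides at \<open>p'\<close>. The edges
  \<open>{u, q'}\<close> and \<open>{z, q}\<close> trap the root in \<open>{z, u}\<close>; then the
  DFS property leaves \<open>q'\<close> only the neighbours \<open>p'\<close> and
  \<open>u\<close>.\<close>

lemma dumbbell_Q: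
  assumes "dumbbell z u p q p' q'" shows "{z, p} \<in> Q"
proof (rule ccontr)
  note dumbbell = assms[unfolded dumbbell_def]
  assume zp: "{z, p} \<notin> Q"
  have EN: "{x, y} \<in> E \<longleftrightarrow> y \<in> nbrs {x}" for x y by (simp add: nbrs_vertex)
  have zQ: "w = u" if "{z, w} \<in> Q" for w
  proof -
    have "w \<in> {p, q, u}" using that dumbbell QE EN by blast
    moreover have "w \<noteq> q" using that dumbbell Q_sym[of z w] unfolding leaf_def by auto
    ultimately show ?thesis using that zp by blast
  qed
  have uQ: "w \<in> {z, p'}" if "{u, w} \<in> Q" for w
  proof -
    have "w \<in> {p', q', z}" using that dumbbell QE EN by blast
    moreover have "w \<noteq> q'" using that dumbbell Q_sym[of u w] unfolding leaf_def by auto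
    ultimately show ?thesis by blast
  qed
  have q'Q: "w = p'" if "{q', w} \<in> Q" for w using that dumbbell by (auto simp: leaf_def)
  let ?X = "{z, u}" and ?Y = "{q'}" and ?W = "V - {p', z, u, q'}"
  have V: "p' \<in> V" "?X \<subseteq> V - {p'}" "?Y \<subseteq> V - {p'}" "?W \<subseteq> V - {p'}"
    "?X \<inter> ?Y = {}" "?X \<inter> ?W = {}" "?Y \<inter> ?W = {}" using dumbbell by auto
  have X: "\<forall>a\<in>?X. \<forall>b. {a, b} \<in> Q \<longrightarrow> b \<in> insert p' ?X" using zQ uQ by blast
  have Y: "\<forall>a\<in>?Y. \<forall>b. {a, b} \<in> Q \<longrightarrow> b \<in> insert p' ?Y" using q'Q by blast
  have W: "\<forall>a\<in>?W. \<forall>b. {a, b} \<in> Q \<longrightarrow> b \<in> insert p' ?W"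
  proof (intro ballI allI impI)
    fix a b assume ab: "a \<in> ?W" "{a, b} \<in> Q"
    then show "b \<in> insert p' ?W"
      using Q_ends[OF ab(2)] zQ[of a] uQ[of a] q'Q[of a] Q_sym[OF ab(2)] by blast
  qed
  have uq': "{u, q'} \<in> E" and zq: "{z, q} \<in> E" and qW: "q \<in> ?W" using dumbbell EN by auto
  have r1: "r \<in> ?X \<union> ?Y" by (rule dfs_root[OF V(1,2,3,5) X Y _ _ uq']) auto
  have r2: "r \<in> ?X \<union> ?W" by (rule dfs_root[OF V(1,2,4,6) X W _ qW zq]) auto
  have "r \<notin> ?Y \<union> ?W" using r1 r2 V by blast
  then have "{q', w} \<notin> E" if "w \<in> ?W" for w
    using dfs_root[OF V(1,3,4,7) Y W _ that] by blast
  moreover have "{q', z} \<notin> E" using dumbbell EN[of z q'] by (auto simp: insert_commute)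
  ultimately have "nbrs {q'} \<subseteq> {p', u}"
    using nbrs_subset[of "{q'}"] nbrs_disjoint[of "{q'}"] EN by blast
  then show False using degree_ge3[of q'] dumbbell by blast
qed

text \<open>\<open>D\<close> is the side of \<open>z\<close> when the tree is cut at
  \<open>{z, u}\<close>. As \<open>z\<close> has no neighbours but \<open>p\<close>,
  \<open>q\<close>, \<open>u\<close>, and \<open>q\<close> is a leaf, everything else in
  \<open>D\<close> hangs at \<open>p\<close>; the other side hangs at \<open>p'\<close> in the same
  way.\<close>

lemma dumbbell_split:
  assumes "dumbbell z u p q p' q'"
  obtains D where "D \<subseteq> V" "z \<in> D" "p \<in> D" "q \<in> D" "u \<notin> D" "p' \<notin> D" "q' \<notin> D"
    "\<And>x y. x \<in> D \<Longrightarrow> {x, y} \<in> Q \<Longrightarrow> y \<in> D \<or> x = z \<and> y = u"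
    "\<And>x y. x \<in> V - D \<Longrightarrow> {x, y} \<in> Q \<Longrightarrow> y \<in> V - D \<or> x = u \<and> y = z"
    "\<And>x y. x \<in> D - {z, p, q} \<Longrightarrow> {x, y} \<in> Q \<Longrightarrow> y \<in> insert p (D - {z, p, q})"
    "\<And>x y. x \<in> V - D - {u, p', q'} \<Longrightarrow> {x, y} \<in> Q \<Longrightarrow> y \<in> insert p' (V - D - {u, p', q'})"
proof -
  note dumbbell = assms[unfolded dumbbell_def]
  have zp: "{z, p} \<in> Q" and up': "{u, p'} \<in> Q" by (rule dumbbell_Q[OF assms] dumbbell_Q[OF dumbbell_sym[OF assms]])+
  obtain D where D: "D \<subseteq> V" "z \<in> D" "u \<notin> D"
    "\<forall>x\<in>D. \<forall>y\<in>V - D. {x, y} \<in> Q \<longrightarrow> x = z \<and> y = u"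
    using cutQ[OF conjunct1[OF dumbbell]] by blast
  have c1: "y \<in> D \<or> x = z \<and> y = u" if "x \<in> D" "{x, y} \<in> Q" for x y
    using that D(4) Q_ends[OF that(2)] by blast
  have c2: "y \<in> V - D \<or> x = u \<and> y = z" if "x \<in> V - D" "{x, y} \<in> Q" for x y
    using that D(4) Q_ends[OF that(2)] Q_sym[OF that(2)] by blast
  have lf: "{p, q} \<in> Q" "{p', q'} \<in> Q" using dumbbell Q_sym[of q p] Q_sym[of q' p'] by (auto simp: leaf_def)
  have dist: "z \<noteq> p" "z \<noteq> p'" "u \<noteq> p" "u \<noteq> p'" "u \<in> V - D" using dumbbell D(3) by auto
  have pD: "p \<in> D" using c1[OF D(2) zp] dist by blast
  have "q \<in> D" using c1[OF pD lf(1)] dist by blast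
  have p'D: "p' \<in> V - D" using c2[OF dist(5) up'] dist by blast
  have "q' \<in> V - D" using c2[OF p'D lf(2)] dist by blast
  have Nz: "x \<in> {p, q, u}" if "{x, z} \<in> Q" for x
    using QE dumbbell nbrs_vertex[of x z] Q_sym[OF that] by blast
  have Nu: "x \<in> {p', q', z}" if "{x, u} \<in> Q" for x
    using QE dumbbell nbrs_vertex[of x u] Q_sym[OF that] by blast
  have Nq: "x = p" if "{x, q} \<in> Q" for x
    using dumbbell Q_sym[OF that] unfolding leaf_def by blast
  have Nq': "x = p'" if "{x, q'} \<in> Q" for x
    using dumbbell Q_sym[OF that] unfolding leaf_def by blast
  have R: "y \<in> insert p (D - {z, p, q})" if "x \<in> D - {z, p, q}" "{x, y} \<in> Q" for x y
    using c1[of x y] Nz[of x] Nq[of x] that D(3) by blast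
  have R': "y \<in> insert p' (V - D - {u, p', q'})" if "x \<in> V - D - {u, p', q'}" "{x, y} \<in> Q" for x y
    using c2[of x y] Nu[of x] Nq'[of x] that D(2) by blast
  show ?thesis
    by (rule that[of D]) (use D(1-3) pD \<open>q \<in> D\<close> p'D \<open>q' \<in> V - D\<close> c1 c2 R R' in simp_all)
qed

text \<open>With the root at \<open>z\<close>, both sides of the cut would be unions of
  \<open>z\<close>-branches, making \<open>z\<close> a cut vertex.\<close>

lemma dumbbell_root_not_inner:
  assumes "dumbbell z u p q p' q'" shows "r \<noteq> z"
proof
  note dumbbell = assms[unfolded dumbbell_def]
  assume rz: "r = z"
  obtain D where D: "D \<subseteq> V" "z \<in> D" "p \<in> D" "u \<notin> D"
    and D1: "\<And>x y. x \<in> D \<Longrightarrow> {x, y} \<in> Q \<Longrightarrow> y \<in> D \<or> x = z \<and> y = u"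
    and D2: "\<And>x y. x \<in> V - D \<Longrightarrow> {x, y} \<in> Q \<Longrightarrow> y \<in> V - D \<or> x = u \<and> y = z"
    by (rule dumbbell_split[OF assms]) blast
  have "{a, b} \<notin> E" if "a \<in> D - {z}" "b \<in> V - D" for a b
  proof (rule dfs[of z "D - {z}" "V - D"])
    show "d \<in> insert z (D - {z})" if "c \<in> D - {z}" "{c, d} \<in> Q" for c d using D1[of c d] that by blast
    show "d \<in> insert z (V - D)" if "c \<in> V - D" "{c, d} \<in> Q" for c d using D2[of c d] that by blast
  qed (use D that rz in auto)
  then have "{b, a} \<notin> E" if "a \<in> D - {z}" "b \<in> V - D" for a b
    using that by (simp add: insert_commute)
  then have "nbrs (D - {z}) \<subseteq> {z, z}" unfolding nbrs_def by blast
  moreover have "u \<in> V - (D - {z}) - {z, z}" "p \<in> D - {z}" using D dumbbell by auto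
  ultimately show False using card_nbrs_le2[of "D - {z}" z z] D(1) by blast
qed

lemma dumbbell_root:
  assumes "dumbbell z u p q p' q'" shows "r \<in> {q, q'}"
proof -
  \<comment> \<open>If the root were \<open>p\<close> or hung at \<open>p\<close>, then
    \<open>{q}\<close> and the side at \<open>p\<close> containing \<open>z\<close> would avoid it,
    although \<open>{z, q}\<close> is an edge. The claim is stated for an arbitrary dumbbell to
    cover both halves.\<close>
  have *: "r \<notin> insert p (D - {z, p, q})"
    if s: "dumbbell z u p q p' q'" and D: "D \<subseteq> V" "z \<in> D" "p \<in> D"
      and R: "\<And>x y. x \<in> D - {z, p, q} \<Longrightarrow> {x, y} \<in> Q \<Longrightarrow> y \<in> insert p (D - {z, p, q})"
    for z u p q p' q' D
  proof
    note dumbbell = s[unfolded dumbbell_def]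
    let ?R = "D - {z, p, q}"
    assume r: "r \<in> insert p ?R"
    have "{q, z} \<notin> E"
    proof (rule dfs[of p "{q}" "V - {p, q} - ?R"])
      show "d \<in> insert p {q}" if "c \<in> {q}" "{c, d} \<in> Q" for c d
        using that dumbbell by (auto simp: leaf_def)
      show "d \<in> insert p (V - {p, q} - ?R)" if "c \<in> V - {p, q} - ?R" "{c, d} \<in> Q" for c d
      proof -
        have "d \<notin> ?R" using R[of d c] that Q_sym by blast
        moreover have "d \<noteq> q" using that dumbbell Q_sym[of c d] unfolding leaf_def by blast
        ultimately show ?thesis using Q_ends[OF that(2)] by blast
      qed
    qed (use D dumbbell r in auto)
    moreover have "{z, q} \<in> E" using dumbbell nbrs_vertex[of q z] by auto
    ultimately show False by (simp add: insert_commute)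
  qed
  obtain D where D: "D \<subseteq> V" "z \<in> D" "p \<in> D" "q \<in> D" "u \<notin> D" "p' \<notin> D" "q' \<notin> D"
    "\<And>x y. x \<in> D - {z, p, q} \<Longrightarrow> {x, y} \<in> Q \<Longrightarrow> y \<in> insert p (D - {z, p, q})"
    "\<And>x y. x \<in> V - D - {u, p', q'} \<Longrightarrow> {x, y} \<in> Q \<Longrightarrow> y \<in> insert p' (V - D - {u, p', q'})"
    by (rule dumbbell_split[OF assms]) blast
  have "r \<notin> insert p (D - {z, p, q})" by (rule *[OF assms D(1-3) D(8)])
  moreover have "r \<notin> insert p' (V - D - {u, p', q'})"
    by (rule *[OF dumbbell_sym[OF assms]]) (use D assms[unfolded dumbbell_def] in \<open>auto simp del: insert_iff\<close>)
  moreover have "r \<noteq> z" "r \<noteq> u" 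
    using dumbbell_root_not_inner[OF assms] dumbbell_root_not_inner[OF dumbbell_sym[OF assms]] .
  ultimately show ?thesis using rV D by blast
qed

lemma dumbbell_all:
  assumes "dumbbell z u p q p' q'" and ex: "exceptional A z u p q" and r: "r = q'"
  shows "V = {z, u, p, q, p', q'}"
proof -
  note dumbbell = assms(1)[unfolded dumbbell_def]
  have EN: "{x, y} \<in> E \<longleftrightarrow> y \<in> nbrs {x}" for x y by (simp add: nbrs_vertex)
  have Esym: "{x, y} \<in> E \<Longrightarrow> {y, x} \<in> E" for x y by (simp add: insert_commute)
  obtain D where D: "D \<subseteq> V" "z \<in> D" "p \<in> D" "q \<in> D" "u \<notin> D" "p' \<notin> D" "q' \<notin> D"
    and cut: "\<And>x y. x \<in> V - D \<Longrightarrow> {x, y} \<in> Q \<Longrightarrow> y \<in> V - D \<or> x = u \<and> y = z"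
    and R: "\<And>x y. x \<in> D - {z, p, q} \<Longrightarrow> {x, y} \<in> Q \<Longrightarrow> y \<in> insert p (D - {z, p, q})"
    and R': "\<And>x y. x \<in> V - D - {u, p', q'} \<Longrightarrow> {x, y} \<in> Q \<Longrightarrow> y \<in> insert p' (V - D - {u, p', q'})"
    by (rule dumbbell_split[OF assms(1)]) blast
  define R1 where "R1 = D - {z, p, q}"
  define R2 where "R2 = V - D - {u, p', q'}"
  have V: "V = {z, u, p, q, p', q'} \<union> R1 \<union> R2" using D dumbbell by (auto simp: R1_def R2_def)
  have R1V: "R1 \<subseteq> V" "R2 \<subseteq> V" using V by auto
  \<comment> \<open>\<open>R2\<close> is a side at \<open>p'\<close> and the root is
    \<open>q'\<close>, so \<open>R2\<close> has no neighbours besides \<open>p'\<close> and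
    \<open>q'\<close>, too few for 3-connectivity.\<close>
  have "R2 = {}"
  proof (rule ccontr)
    assume ne: "R2 \<noteq> {}"
    have "{a, b} \<notin> E" if "a \<in> R2" "b \<in> V - {p', q'} - R2" for a b
    proof (rule dfs[of p' R2 "V - {p', q'} - R2"])
      show "d \<in> insert p' R2" if "c \<in> R2" "{c, d} \<in> Q" for c d using R' that by (simp add: R2_def)
      show "d \<in> insert p' (V - {p', q'} - R2)" if "c \<in> V - {p', q'} - R2" "{c, d} \<in> Q" for c d
      proof -
        have "d \<notin> R2" using R'[of d c] that Q_sym unfolding R2_def by blast
        moreover have "d \<noteq> q'" using that dumbbell Q_sym[of c d] unfolding leaf_def by blast
        ultimately show ?thesis using Q_ends[OF that(2)] by blast
      qed
    qed (use dumbbell r that R1V in \<open>auto simp: R2_def\<close>)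
    then have "nbrs R2 \<subseteq> {p', q'}" using Esym unfolding nbrs_def by blast
    moreover have "z \<in> V - R2 - {p', q'}" using dumbbell D by (auto simp: R2_def)
    ultimately show False using card_nbrs_le2 ne R1V by blast
  qed
  then have V: "V = {z, u, p, q, p', q'} \<union> R1" using V by simp
  have qR: "{q, b} \<notin> E" if "b \<in> R1" for b
  proof (rule dfs[of p "{q}" R1])
    show "d \<in> insert p R1" if "c \<in> R1" "{c, d} \<in> Q" for c d using R that by (simp add: R1_def)
  qed (use dumbbell r D that R1V in \<open>auto simp: R1_def leaf_def\<close>)
  have Nz: "nbrs {z} = {p, q, u}" and Nu: "nbrs {u} = {p', q', z}" using dumbbell by blast+
  have uV: "u \<in> V" and qV: "q \<in> V" and uv: "u \<noteq> p'" "z \<noteq> p'" "z \<noteq> q'"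
    and c3: "card {p, p', q'} = 3" and lf: "leaf q' p'" using dumbbell by simp_all
  have uR: "u \<in> V - R1 - {p, p', q'}" using D(5) dumbbell by (simp add: R1_def)
  have NR: "nbrs R1 \<subseteq> {p, p', q'}"
  proof
    fix v assume "v \<in> nbrs R1"
    then obtain w where w: "v \<in> V" "v \<notin> R1" "w \<in> R1" "{v, w} \<in> E" by (auto simp: nbrs_def)
    have "v \<noteq> q" using qR w by blast
    moreover have "v \<noteq> z" using w(3,4) EN[of z w] Nz D(5) unfolding R1_def by blast
    moreover have "v \<noteq> u" using w(3,4) EN[of u w] Nu D(2,6,7) unfolding R1_def by auto
    ultimately show "v \<in> {p, p', q'}" using w V by blast
  qed
  have A: "end_of leaf_sep_edges A" "p \<in> A" "q \<in> A" "z \<in> nbrs A" "u \<in> V - A - nbrs A" "nbrs A - {z} \<in> leaf_sep_edges"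
    using ex by (auto simp: exceptional_def)
  have AV: "A \<subseteq> V" using A(1) by (auto simp: end_of_def frag_of_def fragment_def)
  have leaf_sub_Q: "e \<in> Q" if "e \<in> leaf_sep_edges" for e using that by (auto simp: leaf_sep_edges_def sep_edges_def)
  \<comment> \<open>If \<open>A\<close> has boundary \<open>{z, p', q'}\<close>, a nonempty
    \<open>R1\<close> would be a smaller fragment inside \<open>A\<close> with
    \<open>{p', q'}\<close> in its boundary. Otherwise \<open>p'\<close> and \<open>q'\<close> lie
    beyond the boundary of \<open>A\<close>, and \<open>q\<close> keeps only the neighbours
    \<open>p\<close> and \<open>z\<close>.\<close>
  show ?thesis
  proof (cases "nbrs A - {z} = {p', q'}")
    case True
    have "R1 = {}"
    proof (rule ccontr)
      assume ne: "R1 \<noteq> {}"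
      \<comment> \<open>No tree edge leaves \<open>R1 - A\<close>: this set avoids
        \<open>nbrs A\<close>, and \<open>p\<close>, the only exit from \<open>R1\<close>, lies in
        \<open>A\<close>.\<close>
      have "R1 - A = {}"
      proof (rule ccontr)
        assume ne: "R1 - A \<noteq> {}"
        have "R1 - A = V"
        proof (rule closed_eq_V)
          fix a b assume a: "a \<in> R1 - A" "{a, b} \<in> Q"
          have "a \<notin> nbrs A" using a True D by (auto simp: R1_def)
          then have "b \<notin> A" using closed_nbr[of b a A] a QE Esym by blast
          moreover have "b \<in> insert p R1" using R[of a b] a by (simp add: R1_def)
          ultimately show "b \<in> R1 - A" using A(2) by blast
        qed (use ne R1V in blast)+
        then show False using A(2) AV by blast
      qed
      then have "R1 \<subset> A" using A(2) by (auto simp: R1_def)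
      moreover have "fragment R1" "nbrs R1 = {p, p', q'}"
        using fragmentI[OF ne R1V(1) NR _ c3] uR by blast+
      then have "frag_of leaf_sep_edges R1"
        using A(6)[unfolded True] unfolding frag_of_def by (intro conjI bexI[of _ "{p', q'}"]) auto
      ultimately show False using A(1) by (auto simp: end_of_def)
    qed
    then show ?thesis using V by simp
  next
    case False
    have eQ: "nbrs A - {z} \<in> Q" using leaf_sub_Q A(6) .
    obtain x y where xy: "nbrs A - {z} = {x, y}" "x \<noteq> y" "{x, y} \<in> Q"
      using edgeE QE eQ by (metis subsetD)
    have q': "q' \<notin> {x, y}"
    proof
      assume "q' \<in> {x, y}"
      then have "{x, y} = {p', q'}"
        using xy(3) lf Q_sym[OF xy(3)] unfolding leaf_def by blast
      then show False using False xy(1) by simp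
    qed
    \<comment> \<open>As \<open>R2\<close> is empty, the tree neighbours of \<open>p'\<close> are
      among \<open>u\<close> and \<open>q'\<close>, and neither belongs to the boundary
      edge.\<close>
    have p': "p' \<notin> {x, y}"
    proof
      assume "p' \<in> {x, y}"
      then obtain w where w: "{x, y} = {p', w}" "{p', w} \<in> Q" using xy(3) by (auto simp: insert_commute)
      then have "w \<in> V - D" using cut[of p' w] uv(1) D(6) Q_ends[OF w(2)] by blast
      moreover have "w \<noteq> q'" using q' w by auto
      moreover have "w \<noteq> u" using A(5) w xy(1) by blast
      moreover have "w \<noteq> p'" using Q_ends[OF w(2)] by blast
      ultimately show False using \<open>R2 = {}\<close> by (auto simp: R2_def)
    qed
    have "v \<notin> A" if "v \<in> {p', q'}" for v
    proof
      assume "v \<in> A"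
      moreover have "{v, u} \<in> E" using that Nu EN[of u v] Esym[of u v] by blast
      ultimately show False using A(5) closed_nbr by blast
    qed
    moreover have "v \<notin> nbrs A" if "v \<in> {p', q'}" for v
      using that p' q' xy(1) uv by blast
    ultimately have "{q, v} \<notin> E" if "v \<in> {p', q', u}" for v
      using that A(3,5) closed_nbr[of q v A] by blast
    then have "nbrs {q} \<subseteq> {p, z}"
      using qR V nbrs_subset[of "{q}"] nbrs_disjoint[of "{q}"] EN by blast
    then show ?thesis using degree_ge3[OF qV] by blast
  qed
qed

lemma dumbbell_vertices:
  assumes H: "\<And>e f. e \<in> Q - sep_edges \<Longrightarrow> f \<in> Q - sep_edges \<Longrightarrow> e = f"
  obtains z u p q p' q' where "dumbbell z u p q p' q'" "V = {z, u, p, q, p', q'}"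
proof -
  have "\<exists>A A' z u p q p' q'. exceptional A z u p q \<and> exceptional A' u z p' q' \<and> {p, q} \<inter> {p', q'} = {}"
    by (rule exceptional_pair) (rule H)
  then obtain A A' z u p q p' q' where ex: "exceptional A z u p q" "exceptional A' u z p' q'"
    "{p, q} \<inter> {p', q'} = {}"
    by (elim exE conjE)
  have s: "dumbbell z u p q p' q'" using exceptional_six[OF ex] .
  then consider "r = q'" | "r = q" using dumbbell_root[OF s] by blast
  then show ?thesis
  proof cases
    case 1
    show ?thesis by (rule that[OF s dumbbell_all[OF s ex(1) 1]])
  next
    case 2
    show ?thesis by (rule that[OF dumbbell_sym[OF s] dumbbell_all[OF dumbbell_sym[OF s] ex(2) 2]])
  qed
qed

section \<open>The edges between the two triangles\<close>

text \<open>Among the four vertices other than \<open>u\<close> and \<open>p'\<close>, only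
  \<open>q'\<close> and \<open>z\<close> are nonadjacent. So both sides of a 3-separator containing
  \<open>{u, p'}\<close> lie in \<open>{q', z}\<close>, which accounts for at most 5 of the 6
  vertices.\<close>

lemma all_cross_not_separating:
  assumes s: "dumbbell z u p q p' q'" and V: "V = {z, u, p, q, p', q'}"
    and cr: "{p', p} \<in> E" "{p', q} \<in> E" "{q', p} \<in> E" "{q', q} \<in> E"
  shows "\<not> separating {u, p'}"
proof
  note dumbbell = s[unfolded dumbbell_def]
  assume "separating {u, p'}"
  then obtain F where F: "fragment F" "{u, p'} \<subseteq> nbrs F" by (auto simp: separating_def)
  let ?C = "V - F - nbrs F"
  have FV: "F \<subseteq> V" using F(1) by (simp add: fragment_def)
  have Nz: "nbrs {z} = {p, q, u}" using dumbbell by blast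
  have "{p, q} \<in> E" using dumbbell QE Q_sym[of q p] by (auto simp: leaf_def)
  moreover have "{z, p} \<in> E" "{z, q} \<in> E" using Nz nbrs_vertex[of _ z] by auto
  ultimately have adj: "{v, w} \<in> E"
    if "v \<in> {q', z, p, q}" "w \<in> {q', z, p, q}" "v \<noteq> w" "{v, w} \<noteq> {q', z}" for v w
    using that cr by (auto simp: insert_commute)
  have sub: "F \<subseteq> {q', z, p, q}" "?C \<subseteq> {q', z, p, q}"
    using F(2) nbrs_disjoint[of F] FV V by blast+
  have cross: "{v, w} = {q', z}" if "v \<in> F" "w \<in> ?C" for v w
    using that adj[of v w] sub closed_nbr[of v w F] by blast
  have "F \<noteq> {}" "?C \<noteq> {}" "card (nbrs F) = 3" using F(1) by (auto simp: fragment_def)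
  then have "F \<union> ?C \<subseteq> {q', z}" using cross by blast
  then have "V \<subseteq> {q', z} \<union> nbrs F" by blast
  then have "card V \<le> card ({q', z} \<union> nbrs F)" using finite_nbrs by (intro card_mono) auto
  also have "\<dots> \<le> card {q', z} + card (nbrs F)" by (rule card_Un_le)
  also have "\<dots> \<le> 5" using \<open>card (nbrs F) = 3\<close> by (simp add: card_insert_if)
  finally have "card V \<le> 5" .
  moreover have "card {z, u, p, q, p', q'} = 6" using dumbbell by simp
  ultimately show False unfolding V by simp
qed

text \<open>\<open>?B\<close> collects the edges forced by the dumbbell and \<open>?M\<close> the
  possible cross edges. Minimum degree 3 forces a perfect matching in \<open>?M\<close>; all four
  cross edges would make \<open>{u, p'}\<close> a second nonseparating tree edge.\<close>

lemma prism_shape: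
  assumes H: "\<And>e f. e \<in> Q - sep_edges \<Longrightarrow> f \<in> Q - sep_edges \<Longrightarrow> e = f"
  shows "\<exists>a0 a1 a2 b0 b1 b2. distinct [a0, a1, a2, b0, b1, b2] \<and> V = {a0, a1, a2, b0, b1, b2} \<and>
    (E = prism_edges a0 a1 a2 b0 b1 b2 \<or> E = insert {a0, b1} (prism_edges a0 a1 a2 b0 b1 b2))"
    (is "\<exists>a0 a1 a2 b0 b1 b2. ?P a0 a1 a2 b0 b1 b2")
proof -
  obtain z u p q p' q' where s: "dumbbell z u p q p' q'" and V: "V = {z, u, p, q, p', q'}"
    by (rule dumbbell_vertices[OF H])
  note dumbbell = s[unfolded dumbbell_def]
  have N: "nbrs {z} = {p, q, u}" "nbrs {u} = {p', q', z}" and zu: "{z, u} \<in> Q" using dumbbell by blast+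
  have dist: "distinct [z, u, p, q, p', q']" using dumbbell by blast
  have pq: "{p, q} \<in> E" "{p', q'} \<in> E"
    using dumbbell QE Q_sym[of q p] Q_sym[of q' p'] by (auto simp: leaf_def)
  have zE: "{z, w} \<in> E \<longleftrightarrow> w \<in> {p, q, u}" "{w, z} \<in> E \<longleftrightarrow> w \<in> {p, q, u}" for w
    using nbrs_vertex[of w z] N by (auto simp: insert_commute)
  have uE: "{u, w} \<in> E \<longleftrightarrow> w \<in> {p', q', z}" "{w, u} \<in> E \<longleftrightarrow> w \<in> {p', q', z}" for w
    using nbrs_vertex[of w u] N by (auto simp: insert_commute)
  let ?B = "{{p', q'}, {p', u}, {q', u}, {p, q}, {p, z}, {q, z}, {u, z}}"
  let ?M = "{{p', p}, {p', q}, {q', p}, {q', q}}"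
  have B: "?B \<subseteq> E" using pq zE uE by auto
  have sub: "E \<subseteq> ?B \<union> ?M"
  proof
    fix e assume e: "e \<in> E"
    then obtain x y where xy: "e = {x, y}" "x \<in> V" "y \<in> V" "x \<noteq> y" using edgeE by blast
    consider "x = z" | "y = z" | "x = u" | "y = u" | "x \<in> {p, q, p', q'}" "y \<in> {p, q, p', q'}"
      using xy V by blast
    then show "e \<in> ?B \<union> ?M"
    proof cases
      case 1
      then have "y \<in> {p, q, u}" using e xy zE by simp
      then show ?thesis unfolding xy(1) 1 by (elim insertE emptyE) (simp_all add: doubleton_eq_iff)
    next
      case 2
      then have "x \<in> {p, q, u}" using e xy zE by simp
      then show ?thesis unfolding xy(1) 2 by (elim insertE emptyE) (simp_all add: doubleton_eq_iff)
    next
      case 3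
      then have "y \<in> {p', q', z}" using e xy uE by simp
      then show ?thesis unfolding xy(1) 3 by (elim insertE emptyE) (simp_all add: doubleton_eq_iff)
    next
      case 4
      then have "x \<in> {p', q', z}" using e xy uE by simp
      then show ?thesis unfolding xy(1) 4 by (elim insertE emptyE) (simp_all add: doubleton_eq_iff)
    next
      case 5
      then show ?thesis using xy(4) unfolding xy(1)
        by (elim insertE emptyE) (simp_all add: doubleton_eq_iff)
    qed
  qed
  have "E = B0 \<union> X" if "B0 \<subseteq> E" "E \<subseteq> B0 \<union> M0" "M0 \<inter> E = X" for B0 M0 X
    using that by blast
  note E = this[OF B sub]
  have deg: "{v, w1} \<in> E \<or> {v, w2} \<in> E"
    if "v \<in> V" "nbrs {v} \<subseteq> {a, b, w1, w2}" for v a b w1 w2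
  proof (rule ccontr)
    assume "\<not> ?thesis"
    then have "nbrs {v} \<subseteq> {a, b}" using that(2) nbrs_vertex[of _ v] by blast
    then show False using degree_ge3[OF that(1)] by blast
  qed
  have nb: "nbrs {v} \<subseteq> V - {v}" for v by (auto simp: nbrs_def)
  have "u \<notin> nbrs {p}" "u \<notin> nbrs {q}" "z \<notin> nbrs {p'}" "z \<notin> nbrs {q'}"
    using dist by (auto simp: nbrs_vertex zE uE)
  then have "nbrs {p} \<subseteq> {q, z, p', q'}" "nbrs {q} \<subseteq> {p, z, p', q'}"
    "nbrs {p'} \<subseteq> {q', u, p, q}" "nbrs {q'} \<subseteq> {p', u, p, q}"
    using nb[of p] nb[of q] nb[of p'] nb[of q'] V by blast+
  then have "{p, p'} \<in> E \<or> {p, q'} \<in> E" "{q, p'} \<in> E \<or> {q, q'} \<in> E"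
    "{p', p} \<in> E \<or> {p', q} \<in> E" "{q', p} \<in> E \<or> {q', q} \<in> E"
    using deg[of p q z p' q'] deg[of q p z p' q'] deg[of p' q' u p q] deg[of q' p' u p q] V by blast+
  then have "{p', p} \<in> E \<and> {q', q} \<in> E \<or> {p', q} \<in> E \<and> {q', p} \<in> E"
    by (auto simp: insert_commute)
  moreover have "\<not> ({p', p} \<in> E \<and> {q', q} \<in> E \<and> {p', q} \<in> E \<and> {q', p} \<in> E)"
  proof
    assume "{p', p} \<in> E \<and> {q', q} \<in> E \<and> {p', q} \<in> E \<and> {q', p} \<in> E"
    then have "\<not> separating {u, p'}" using all_cross_not_separating[OF s V] by blast
    then have "{u, p'} \<in> Q - sep_edges" using dumbbell_Q[OF dumbbell_sym[OF s]] by (auto simp: sep_edges_def)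
    moreover have "{z, u} \<in> Q - sep_edges" using zu not_separating[OF N(1) pq(1)] by (auto simp: sep_edges_def)
    ultimately show False using H[of "{u, p'}" "{z, u}"] dist by (auto simp: doubleton_eq_iff)
  qed
  \<comment> \<open>The sets of cross edges containing a perfect matching, other than all of
    \<open>?M\<close>. In the cases with three edges the labelling is chosen so that
    \<open>{a0, b1}\<close> is the edge outside the matching.\<close>
  ultimately consider
      "{p', p} \<in> E" "{p', q} \<notin> E" "{q', p} \<notin> E" "{q', q} \<in> E"
    | "{p', p} \<notin> E" "{p', q} \<in> E" "{q', p} \<in> E" "{q', q} \<notin> E"
    | "{p', p} \<in> E" "{p', q} \<in> E" "{q', p} \<notin> E" "{q', q} \<in> E"
    | "{p', p} \<in> E" "{p', q} \<notin> E" "{q', p} \<in> E" "{q', q} \<in> E"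
    | "{p', p} \<in> E" "{p', q} \<in> E" "{q', p} \<in> E" "{q', q} \<notin> E"
    | "{p', p} \<notin> E" "{p', q} \<in> E" "{q', p} \<in> E" "{q', q} \<in> E"
    by blast
  then show ?thesis
  proof cases
    case 1
    then have "?M \<inter> E = {{p', p}, {q', q}}" by (simp add: Int_insert_left)
    then have "?P p' q' u p q z" using E dist V by (auto simp: prism_edges_def insert_commute)
    then show ?thesis by blast
  next
    case 2
    then have "?M \<inter> E = {{p', q}, {q', p}}" by (simp add: Int_insert_left)
    then have "?P p' q' u q p z" using E dist V by (auto simp: prism_edges_def insert_commute)
    then show ?thesis by blast
  next
    case 3
    then have "?M \<inter> E = {{p', p}, {p', q}, {q', q}}" by (simp add: Int_insert_left)
    then have "?P p' q' u p q z" using E dist V by (auto simp: prism_edges_def insert_commute)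
    then show ?thesis by blast
  next
    case 4
    then have "?M \<inter> E = {{p', p}, {q', p}, {q', q}}" by (simp add: Int_insert_left)
    then have "?P q' p' u q p z" using E dist V by (auto simp: prism_edges_def insert_commute)
    then show ?thesis by blast
  next
    case 5
    then have "?M \<inter> E = {{p', p}, {p', q}, {q', p}}" by (simp add: Int_insert_left)
    then have "?P p' q' u q p z" using E dist V by (auto simp: prism_edges_def insert_commute)
    then show ?thesis by blast
  next
    case 6
    then have "?M \<inter> E = {{p', q}, {q', p}, {q', q}}" by (simp add: Int_insert_left)
    then have "?P q' p' u p q z" using E dist V by (auto simp: prism_edges_def insert_commute)
    then show ?thesis by blast
  qed
qed

end

section \<open>Connectivity, contraction and trees\<close>

lemma connected_closed:
  assumes "connected_graph H" "X \<subseteq> verts H" "X \<noteq> {}"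
    "\<And>x y. x \<in> X \<Longrightarrow> {x, y} \<in> edges H \<Longrightarrow> y \<in> X"
  shows "X = verts H"
proof -
  obtain x where x: "x \<in> X" using assms(3) by blast
  have "v \<in> X" if "(adjacent H)\<^sup>*\<^sup>* x v" for v
    using that by induction (use x assms(4) in \<open>auto simp: adjacent_def\<close>)
  then show ?thesis using assms(1,2) x unfolding connected_graph_def by blast
qed

lemma not_connected_closed:
  assumes "\<not> connected_graph H" "verts H \<noteq> {}" "\<forall>x y. {x, y} \<in> edges H \<longrightarrow> y \<in> verts H"
  shows "\<exists>X\<subseteq>verts H. X \<noteq> {} \<and> X \<noteq> verts H \<and> (\<forall>x\<in>X. \<forall>y. {x, y} \<in> edges H \<longrightarrow> y \<in> X)"
proof -
  obtain u v where uv: "u \<in> verts H" "v \<in> verts H" "\<not> (adjacent H)\<^sup>*\<^sup>* u v"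
    using assms(1,2) by (auto simp: connected_graph_def)
  let ?X = "{w \<in> verts H. (adjacent H)\<^sup>*\<^sup>* u w}"
  have "y \<in> ?X" if "x \<in> ?X" "{x, y} \<in> edges H" for x y
    using that assms(3) by (auto simp: adjacent_def intro: rtranclp.rtrancl_into_rtrancl)
  moreover have "?X \<noteq> {}" "?X \<noteq> verts H" using uv by auto
  ultimately show ?thesis by (intro exI[of _ ?X]) blast
qed

text \<open>If \<open>N\<close> had fewer than \<open>k\<close> vertices, deleting it would separate
  \<open>F\<close> from the vertices beyond.\<close>

lemma k_connected_card_nbrs:
  assumes "k_connected k G" "F \<subseteq> verts G" "F \<noteq> {}"
    and "\<And>x y. {x, y} \<in> edges G \<Longrightarrow> y \<in> verts G"
  defines "N \<equiv> {v \<in> verts G - F. \<exists>w\<in>F. {v, w} \<in> edges G}"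
  assumes "verts G - F - N \<noteq> {}"
  shows "card N \<ge> k"
proof (rule ccontr)
  assume "\<not> card N \<ge> k"
  moreover have "N \<subseteq> verts G" by (auto simp: N_def)
  ultimately have c: "connected_graph (delete_verts G N)"
    using assms(1) unfolding k_connected_def by simp
  have "F = verts (delete_verts G N)"
  proof (rule connected_closed[OF c _ assms(3)])
    show "F \<subseteq> verts (delete_verts G N)" using assms(2) by (auto simp: delete_verts_def N_def)
    show "y \<in> F" if "x \<in> F" "{x, y} \<in> edges (delete_verts G N)" for x y
    proof (rule ccontr)
      assume "y \<notin> F"
      have "{x, y} \<in> edges G" "y \<notin> N" using that(2) by (auto simp: delete_verts_def)
      moreover from this have "y \<in> verts G" using assms(4) by blast
      ultimately show False using \<open>y \<notin> F\<close> that(1) by (auto simp: N_def insert_commute)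
    qed
  qed
  then show False using assms(6) by (auto simp: delete_verts_def)
qed

lemma simple_graph_edge:
  assumes "simple_graph G" "e \<in> edges G"
  shows "\<exists>x\<in>verts G. \<exists>y\<in>verts G. x \<noteq> y \<and> e = {x, y}"
proof -
  have "e \<subseteq> verts G" "card e = 2" using assms by (auto simp: simple_graph_def)
  then show ?thesis by (auto simp: card_2_iff)
qed

lemma simple_graph_ends:
  "simple_graph G \<Longrightarrow> {x, y} \<in> edges G \<Longrightarrow> x \<in> verts G \<and> y \<in> verts G \<and> x \<noteq> y"
  using simple_graph_edge[of G "{x, y}"] by (auto simp: doubleton_eq_iff)

text \<open>Deleting all but two vertices deletes only \<open>k - 1\<close> of them, so the
  remaining two must be adjacent.\<close>

lemma graph_iso_complete_graph:
  assumes G: "simple_graph G" and conn: "k_connected k G" and card: "card (verts G) = Suc k"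
  shows "graph_iso G (complete_graph (Suc k))"
proof -
  have fin: "finite (verts G)" using G by (simp add: simple_graph_def)
  have adj: "{x, y} \<in> edges G" if xy: "x \<in> verts G" "y \<in> verts G" "x \<noteq> y" for x y
  proof (rule ccontr)
    assume no: "{x, y} \<notin> edges G"
    let ?T = "verts G - {x, y}"
    have "card ?T = card (verts G) - card {x, y}" using xy fin by (intro card_Diff_subset) auto
    then have "card ?T < k" using card xy(3) card_mono[OF fin, of "{x, y}"] xy by auto
    then have c: "connected_graph (delete_verts G ?T)" using conn by (simp add: k_connected_def)
    have "{x} = verts (delete_verts G ?T)"
    proof (rule connected_closed[OF c])
      show "b \<in> {x}" if "a \<in> {x}" "{a, b} \<in> edges (delete_verts G ?T)" for a b
        using that no simple_graph_ends[OF G, of a b] by (auto simp: delete_verts_def)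
    qed (use xy in \<open>auto simp: delete_verts_def\<close>)
    then show False using xy by (auto simp: delete_verts_def)
  qed
  have E: "edges G = {e. e \<subseteq> verts G \<and> card e = 2}"
    using G adj by (auto simp: simple_graph_def card_2_iff)
  obtain f where f: "bij_betw f (verts G) {..<Suc k}"
    using ex_bij_betw_finite_nat[OF fin] card by (auto simp: atLeast0LessThan)
  then have inj: "inj_on f (verts G)" and im: "f ` verts G = {..<Suc k}"
    by (auto simp: bij_betw_def)
  have "edges (complete_graph (Suc k)) = (\<lambda>e. f ` e) ` edges G"
  proof
    show "edges (complete_graph (Suc k)) \<subseteq> (\<lambda>e. f ` e) ` edges G"
    proof
      fix d assume "d \<in> edges (complete_graph (Suc k))"
      then have d: "d \<subseteq> f ` verts G" "card d = 2" by (auto simp: complete_graph_def im)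
      then obtain e where "e \<subseteq> verts G" "d = f ` e" by (auto simp: subset_image_iff)
      then show "d \<in> (\<lambda>e. f ` e) ` edges G"
        using d(2) card_image[OF inj_on_subset[OF inj]] E by auto
    qed
    show "(\<lambda>e. f ` e) ` edges G \<subseteq> edges (complete_graph (Suc k))"
    proof
      fix d assume "d \<in> (\<lambda>e. f ` e) ` edges G"
      then obtain e where e: "e \<subseteq> verts G" "card e = 2" "d = f ` e" by (auto simp: E)
      then have "card d = 2" using card_image[OF inj_on_subset[OF inj e(1)]] by simp
      moreover have "d \<subseteq> {..<Suc k}" using e im by blast
      ultimately show "d \<in> edges (complete_graph (Suc k))" by (simp add: complete_graph_def)
    qed
  qed
  then show ?thesis unfolding graph_iso_def using f by (auto simp: complete_graph_def)
qed

text \<open>A separator \<open>T\<close> of at most 2 vertices in the contraction lifts to a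
  separator \<open>T'\<close> of \<open>G\<close>, which has at least 3 vertices. The lift gains a
  vertex only if \<open>T\<close> contains the contracted vertex; then \<open>T'\<close> is a
  3-separator containing \<open>e\<close>.\<close>

lemma (in conn3) contractible_if_not_separating:
  assumes G: "V = verts G" "E = edges G" and e: "e \<in> E" "\<not> separating e"
  shows "k_connected 3 (contract G e)"
  unfolding k_connected_def
proof (intro conjI allI impI)
  let ?H = "contract G e" and ?c = "contract_vertex e"
  obtain x y where xy: "e = {x, y}" "x \<in> V" "y \<in> V" "x \<noteq> y" using edgeE[OF e(1)] by blast
  have vH: "verts ?H = ?c ` V" by (simp add: contract_def G)
  have finH: "finite (verts ?H)" using finV by (simp add: vH)
  have "inj_on ?c (V - {y})" unfolding inj_on_def contract_vertex_def xy(1) by auto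
  then have "card (V - {y}) \<le> card (verts ?H)"
    unfolding vH using finV by (intro card_inj_on_le[of ?c]) auto
  then show cH: "card (verts ?H) > 3" using card_V xy(3) finV by simp
  fix T assume T: "T \<subseteq> verts ?H" "card T < 3"
  let ?D = "delete_verts ?H T"
  show "connected_graph ?D"
  proof (rule ccontr)
    assume nc: "\<not> connected_graph ?D"
    have vD: "verts ?D = ?c ` V - T" by (simp add: delete_verts_def vH)
    have "\<not> verts ?H \<subseteq> T" using cH T finH card_mono[OF finite_subset[OF T(1) finH]] by fastforce
    then have ne: "verts ?D \<noteq> {}" by (auto simp: delete_verts_def)
    have eD: "b \<in> verts ?D" if "{a, b} \<in> edges ?D" for a b
    proof -
      have "{a, b} \<in> edges ?H" "b \<notin> T" using that by (auto simp: delete_verts_def)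
      then obtain f where f: "f \<in> E" "{a, b} = ?c ` f" by (auto simp: contract_def G)
      have "?c ` f \<subseteq> ?c ` V" using edgeE[OF f(1)] by auto
      moreover have "b \<in> ?c ` f" by (simp flip: f(2))
      ultimately have "b \<in> ?c ` V" ..
      then show ?thesis using \<open>b \<notin> T\<close> vD by blast
    qed
    obtain X where X: "X \<subseteq> verts ?D" "X \<noteq> {}" "X \<noteq> verts ?D"
      and Xc: "\<forall>a\<in>X. \<forall>b. {a, b} \<in> edges ?D \<longrightarrow> b \<in> X"
      using not_connected_closed[OF nc ne] eD by auto
    define X' where "X' = {v \<in> V. ?c v \<in> X}"
    define T' where "T' = {v \<in> V. ?c v \<in> T}"
    have X': "X' \<subseteq> V" "X' \<noteq> {}" using X(1,2) unfolding vD X'_def by blast+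
    have rest: "V - X' - T' \<noteq> {}" using X(1,3) unfolding vD X'_def T'_def by blast
    have sub: "nbrs X' \<subseteq> T'"
    proof
      fix b assume "b \<in> nbrs X'"
      then obtain a where a: "b \<in> V" "b \<notin> X'" "a \<in> X'" "{a, b} \<in> E"
        by (auto simp: nbrs_def insert_commute)
      show "b \<in> T'"
      proof (rule ccontr)
        assume "b \<notin> T'"
        have ab: "?c a \<in> X" "?c b \<notin> T" "?c a \<notin> T" "?c b \<notin> X"
          using a \<open>b \<notin> T'\<close> X(1) vD by (auto simp: X'_def T'_def)
        then have "?c ` {a, b} \<noteq> {e}" by auto
        then have "?c ` {a, b} \<in> edges ?H" using a(4) unfolding contract_def G ugraph.simps by blast
        then have "{?c a, ?c b} \<in> edges ?H" by simp
        then have "{?c a, ?c b} \<in> edges ?D" using ab by (simp add: delete_verts_def)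
        then show False using Xc ab by blast
      qed
    qed
    have finT: "finite T" using T(1) finH finite_subset by blast
    have finT': "finite T'" using finV by (simp add: T'_def)
    have "card (nbrs X') \<ge> 3" using card_nbrs_ge[OF X' sub rest] .
    then have T'3: "card T' \<ge> 3" using card_mono[OF finT' sub] by simp
    have "card (T' - e) \<le> card (T - {e})"
      by (rule card_inj_on_le[of "\<lambda>v. {v}"])
        (use finT in \<open>auto simp: T'_def contract_vertex_def xy(1) split: if_splits\<close>)
    moreover have "card T' \<le> card (T' - e) + card (T' \<inter> e)"
      using card_Un_le[of "T' - e" "T' \<inter> e"] by (simp add: Un_Diff_Int)
    ultimately have cT': "card T' \<le> card (T - {e}) + card (T' \<inter> e)" by linarith
    have "e \<in> T"
    proof (rule ccontr)
      assume "e \<notin> T"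
      then have "T' \<inter> e = {}" by (auto simp: T'_def contract_vertex_def)
      then show False using cT' T'3 T(2) \<open>e \<notin> T\<close> by simp
    qed
    then have "e \<subseteq> T'" using xy by (auto simp: T'_def contract_vertex_def)
    then have "card (T' \<inter> e) = 2" using xy by (simp add: inf.absorb2)
    moreover have "card (T - {e}) \<le> 1" using T(2) \<open>e \<in> T\<close> finT by simp
    ultimately have "card T' = 3" using cT' T'3 by linarith
    then have "fragment X'" "nbrs X' = T'" using fragmentI[OF X'(2,1) sub rest] by blast+
    then show False using e(2) \<open>e \<subseteq> T'\<close> by (auto simp: separating_def)
  qed
qed

section \<open>Cuts and branches of the tree\<close>

text \<open>When the next step returns to a vertex already on the path, the path is truncated
  there.\<close>

lemma rtranclp_distinct_path:
  assumes "R\<^sup>*\<^sup>* a b"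
  shows "\<exists>xs. xs \<noteq> [] \<and> hd xs = a \<and> last xs = b \<and> distinct xs \<and> successively R xs"
  using assms
proof induction
  case base
  show ?case by (intro exI[of _ "[a]"]) simp
next
  case (step y z)
  then obtain xs where xs: "xs \<noteq> []" "hd xs = a" "last xs = y" "distinct xs" "successively R xs"
    by blast
  show ?case
  proof (cases "z \<in> set xs")
    case True
    then obtain ys zs where ys: "xs = ys @ z # zs" by (meson split_list)
    then have "successively R ((ys @ [z]) @ zs)" using xs(5) by simp
    then have "successively R (ys @ [z])" by (rule successively_append_iff[THEN iffD1, THEN conjunct1])
    moreover have "hd (ys @ [z]) = a" using ys xs(2) by (cases ys) auto
    ultimately show ?thesis using xs(4) ys by (intro exI[of _ "ys @ [z]"]) auto
  next
    case False
    then show ?thesis using xs step(2)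
      by (intro exI[of _ "xs @ [z]"]) (auto simp: successively_append_iff)
  qed
qed

text \<open>\<open>D\<close> is what \<open>z\<close> reaches without the edge
  \<open>{z, u}\<close>. If it reached \<open>u\<close>, a distinct path closed by that edge would
  be a cycle; since the path avoids the edge, it has the 3 vertices that \<open>is_cycle\<close>
  demands.\<close>

lemma tree_cut:
  assumes T: "tree Q" and zu: "{z, u} \<in> edges Q"
  shows "\<exists>D\<subseteq>verts Q. z \<in> D \<and> u \<notin> D \<and> (\<forall>x\<in>D. \<forall>y\<in>verts Q - D. {x, y} \<in> edges Q \<longrightarrow> x = z \<and> y = u)"
proof -
  define R where "R a b \<longleftrightarrow> {a, b} \<in> edges Q - {{z, u}}" for a b
  have s: "simple_graph Q" using T by (simp add: tree_def)
  have ends: "x \<in> verts Q \<and> y \<in> verts Q \<and> x \<noteq> y" if "{x, y} \<in> edges Q" for x y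
    using simple_graph_ends[OF s that] .
  define D where "D = {v. R\<^sup>*\<^sup>* z v}"
  have "v \<in> verts Q" if "R\<^sup>*\<^sup>* z v" for v
    using that by induction (use ends zu in \<open>auto simp: R_def\<close>)
  then have DV: "D \<subseteq> verts Q" by (auto simp: D_def)
  have zD: "z \<in> D" by (simp add: D_def)
  have uD: "u \<notin> D"
  proof
    assume "u \<in> D"
    then obtain xs where xs: "xs \<noteq> []" "hd xs = z" "last xs = u" "distinct xs" "successively R xs"
      using rtranclp_distinct_path[of R z u] by (auto simp: D_def)
    have R: "R (xs ! i) (xs ! Suc i)" if "Suc i < length xs" for i
      using xs(5) that by (simp add: successively_conv_nth)
    have h: "xs ! 0 = z" "xs ! (length xs - 1) = u"
      using xs(1-3) by (simp_all add: hd_conv_nth last_conv_nth)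
    have "length xs \<noteq> 1" using h ends[OF zu] by auto
    moreover have "length xs \<noteq> 2" using R[of 0] h by (auto simp: R_def)
    moreover have "length xs \<noteq> 0" using xs(1) by simp
    ultimately have len: "length xs \<ge> 3" by linarith
    have adj: "adjacent Q (xs ! i) (xs ! (Suc i mod length xs))" if "i < length xs" for i
    proof (cases "Suc i = length xs")
      case True
      then have "i = length xs - 1" by simp
      then show ?thesis using True h zu by (simp add: adjacent_def insert_commute)
    next
      case False
      then show ?thesis using R[of i] that by (simp add: adjacent_def R_def)
    qed
    have "set xs \<subseteq> verts Q"
    proof
      fix v assume "v \<in> set xs"
      then obtain i where "i < length xs" "v = xs ! i" by (metis in_set_conv_nth)
      then show "v \<in> verts Q" using adj[of i] ends by (auto simp: adjacent_def)
    qed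
    then have "is_cycle Q xs" using len xs(4) adj by (simp add: is_cycle_def)
    then show False using T by (auto simp: tree_def)
  qed
  have "x = z \<and> y = u" if "x \<in> D" "y \<in> verts Q - D" "{x, y} \<in> edges Q" for x y
  proof -
    have "\<not> R x y" using that(1,2) by (auto simp: D_def intro: rtranclp.rtrancl_into_rtrancl)
    then have "{x, y} = {z, u}" using that(3) by (auto simp: R_def)
    then show ?thesis using that(1) uD by (auto simp: doubleton_eq_iff)
  qed
  then show ?thesis using DV zD uD by blast
qed

text \<open>Tree edges leave \<open>X\<close> and \<open>Y\<close> only through \<open>x\<close>, so
  the components of \<open>a\<close> and \<open>b\<close> without \<open>x\<close> stay inside these
  disjoint sets and are distinct branches.\<close>

lemma dfs_tree_sides:
  assumes dfs: "dfs_tree G Q r"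
    and x: "x \<in> verts G" "X \<subseteq> verts G - {x}" "Y \<subseteq> verts G - {x}" "X \<inter> Y = {}" "r \<notin> X \<union> Y"
    and X: "\<And>a b. a \<in> X \<Longrightarrow> {a, b} \<in> edges Q \<Longrightarrow> b \<in> insert x X"
    and Y: "\<And>a b. a \<in> Y \<Longrightarrow> {a, b} \<in> edges Q \<Longrightarrow> b \<in> insert x Y"
    and ab: "a \<in> X" "b \<in> Y"
  shows "{a, b} \<notin> edges G"
proof -
  let ?Q = "delete_verts Q {x}"
  let ?B = "\<lambda>a. {v \<in> verts ?Q. (adjacent ?Q)\<^sup>*\<^sup>* a v}"
  have vQ: "verts ?Q = verts G - {x}"
    using dfs by (simp add: dfs_tree_def spanning_tree_def delete_verts_def)
  have branch: "?B a \<subseteq> W \<and> ?B a \<in> branches Q r x \<and> a \<in> ?B a"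
    if W: "W \<subseteq> verts G - {x}" "r \<notin> W" "a \<in> W"
      "\<And>a b. a \<in> W \<Longrightarrow> {a, b} \<in> edges Q \<Longrightarrow> b \<in> insert x W" for W a
  proof -
    have "v \<in> W" if "(adjacent ?Q)\<^sup>*\<^sup>* a v" for v
      using that
    proof induction
      case (step c d)
      then have "{c, d} \<in> edges Q" "d \<noteq> x" by (auto simp: adjacent_def delete_verts_def)
      then show ?case using W(4) step.IH by blast
    qed (use W(3) in simp)
    then have sub: "?B a \<subseteq> W" by blast
    moreover have "?B a \<in> components ?Q" using W(1,3) vQ by (auto simp: components_def)
    ultimately show ?thesis using W vQ by (auto simp: branches_def)
  qed
  obtain A where A: "A \<subseteq> X" "A \<in> branches Q r x" "a \<in> A"
    using branch[of X a] x(2,5) X ab(1) by blast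
  obtain B where B: "B \<subseteq> Y" "B \<in> branches Q r x" "b \<in> B"
    using branch[of Y b] x(3,5) Y ab(2) by blast
  have "A \<noteq> B" using A(1) B(3) ab(2) x(4) by blast
  then have "\<not> adjacent G a b" using dfs x(1) A(2,3) B(2,3) unfolding dfs_tree_def by metis
  then show ?thesis by (simp add: adjacent_def)
qed

theorem theorem1:
  fixes G Q :: "'a ugraph" and r :: 'a
  assumes "simple_graph G"
    and "k_connected 3 G"
    and "\<not> graph_iso G (complete_graph 4)"
    and "\<not> graph_iso G prism"
    and "\<not> graph_iso G prism_plus"
    and "dfs_tree G Q r"
  shows "card {e \<in> edges Q. k_contractible 3 G e} \<ge> 2"
proof (rule ccontr)
  assume few: "\<not> card {e \<in> edges Q. k_contractible 3 G e} \<ge> 2"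
  have tree: "tree Q" "verts Q = verts G" "edges Q \<subseteq> edges G" and r: "r \<in> verts G"
    using assms(6) by (auto simp: dfs_tree_def spanning_tree_def)
  have fin: "finite (verts G)" using assms(1) by (simp add: simple_graph_def)
  \<comment> \<open>The exclusion of the complete graph on 4 vertices serves only to get 5 vertices,
    as \<open>conn3\<close> requires.\<close>
  have "card (verts G) \<noteq> Suc 3"
    using graph_iso_complete_graph[OF assms(1,2)] assms(3) by auto
  then have c5: "card (verts G) \<ge> 5" using assms(2) by (simp add: k_connected_def)
  interpret conn3 "verts G" "edges G"
    by unfold_locales (use fin simple_graph_edge[OF assms(1)] c5
        k_connected_card_nbrs[OF assms(2)] simple_graph_ends[OF assms(1)] in blast)+
  interpret dfs3 "verts G" "edges G" "edges Q" r
  proof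
    have conn: "connected_graph Q" using tree(1) by (simp add: tree_def)
    show "\<exists>x\<in>X. \<exists>y\<in>verts G - X. {x, y} \<in> edges Q"
      if X: "X \<subseteq> verts G" "X \<noteq> {}" "X \<noteq> verts G" for X
    proof (rule ccontr)
      assume no: "\<not> ?thesis"
      have "X = verts Q"
      proof (rule connected_closed[OF conn])
        show "y \<in> X" if "x \<in> X" "{x, y} \<in> edges Q" for x y
          using no that simple_graph_ends[OF assms(1), of x y] tree(3) by blast
      qed (use X tree(2) in auto)
      then show False using X tree(2) by simp
    qed
    show "\<exists>D\<subseteq>verts G. z \<in> D \<and> u \<notin> D \<and> (\<forall>x\<in>D. \<forall>y\<in>verts G - D. {x, y} \<in> edges Q \<longrightarrow> x = z \<and> y = u)"
      if "{z, u} \<in> edges Q" for z u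
      using tree_cut[OF tree(1) that] unfolding tree(2) .
    show "edges Q \<subseteq> edges G" by (rule tree(3))
    show "r \<in> verts G" by (rule r)
  qed (rule dfs_tree_sides[OF assms(6)])
  have contr: "e \<in> {e \<in> edges Q. k_contractible 3 G e}" if "e \<in> edges Q - sep_edges" for e
    using that tree(3) contractible_if_not_separating[of G e] assms(2)
    by (auto simp: sep_edges_def k_contractible_def)
  have finQ: "finite {e \<in> edges Q. k_contractible 3 G e}"
    by (rule finite_subset[of _ "Pow (verts G)"])
      (use fin tree(3) assms(1) in \<open>auto simp: simple_graph_def\<close>)
  \<comment> \<open>Nonseparating tree edges are contractible, so there is at most one of them; this
    is the hypothesis of \<open>prism_shape\<close>.\<close>
  have H: "e = f" if "e \<in> edges Q - sep_edges" "f \<in> edges Q - sep_edges" for e f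
  proof (rule ccontr)
    assume "e \<noteq> f"
    then have "card {e, f} \<le> card {e \<in> edges Q. k_contractible 3 G e}"
      using contr[OF that(1)] contr[OF that(2)] finQ by (intro card_mono) auto
    then show False using few \<open>e \<noteq> f\<close> by simp
  qed
  obtain a0 a1 a2 b0 b1 b2 where d: "distinct [a0, a1, a2, b0, b1, b2]" "verts G = {a0, a1, a2, b0, b1, b2}"
    and E: "edges G = prism_edges a0 a1 a2 b0 b1 b2 \<or>
      edges G = insert {a0, b1} (prism_edges a0 a1 a2 b0 b1 b2)"
    using prism_shape H by metis
  show False using E graph_iso_prism[OF d] assms(4,5) by metis
qed

end
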